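(* Let $\mathbb H$ be a graded affine Hecke algebra. Every irreducible tempered $\mathbb H$-module with real central character admits a (nondegenerate) $\bullet$-invariant hermitian form.
   Context: $V,V^\vee$ are finite dimensional real vector spaces with a perfect pairing $(\ ,\ )$; $R\subset V$, $R^\vee\subset V^\vee$ form a reduced root system with Weyl group $W$ and simple roots $\Pi$; $k:\Pi\to\mathbb R$ is constant on $W$-conjugate simple roots; $V_{\mathbb C},V_{\mathbb C}^\vee$ are the complexifications, with conjugations $\bar{\ }$. The graded affine Hecke algebra $\mathbb H$ is the unital associative $\mathbb C$-algebra generated by $S(V_{\mathbb C})$ and $\{t_w:w\in W\}$ such that $w\otimes a\mapsto t_wa$ is an isomorphism $\mathbb C[W]\otimes S(V_{\mathbb C})\cong\mathbb H$ of $(\mathbb C[W],S(V_{\mathbb C}))$-bimodules and $a\,t_{s_\alpha}=t_{s_\alpha}s_\alpha(a)+k_\alpha\frac{a-s_\alpha(a)}{\alpha}$ for $\alpha\in\Pi$, $a\in S(V_{\mathbb C})$. Its center is $S(V_{\mathbb C})^W$; central characters of irreducible modules are $W$-orbits in $V_{\mathbb C}^\vee$, real if contained in $V^\vee$. $\Omega(X)\subset V_{\mathbb C}^\vee$ is the set of generalized $S(V_{\mathbb C})$-weights of $X$. An irreducible module $X$ is tempered if $(\omega,\mathrm{Re}\,\lambda)\le0$ for all $\lambda\in\Omega(X)$ and all $\omega\in V$ with $(\omega,\alpha^\vee)>0$ for every $\alpha\in\Pi$. The operation $\bullet$ is the conjugate-linear anti-automorphism with $t_w^\bullet=t_{w^{-1}}$,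 $\omega^\bullet=\overline\omega$ ($\omega\in V_{\mathbb C}$); a hermitian form on $(\pi,X)$ is $\bullet$-invariant if $\langle\pi(h)x,y\rangle=\langle x,\pi(h^\bullet)y\rangle$ for all $h\in\mathbb H$. *)

theory Defs
  imports Complex_Main "HOL-Library.FuncSet"
begin

section \<open>Complexification\<close>

text \<open>The complexification of a real vector space consists of pairs; \<open>(x, y)\<close> stands for \<open>x + i y\<close>.\<close>

type_synonym 'a cplxn = "'a \<times> 'a"

definition cconj :: "'a::real_vector cplxn \<Rightarrow> 'a cplxn" where
  "cconj z = (fst z, - snd z)"

definition cpair :: "('v \<Rightarrow> 'd \<Rightarrow> real) \<Rightarrow> 'v cplxn \<Rightarrow> 'd cplxn \<Rightarrow> complex" where
  "cpair pair w l =
     Complex (pair (fst w) (fst l) - pair (snd w) (snd l))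
             (pair (fst w) (snd l) + pair (snd w) (fst l))"


section \<open>Root systems\<close>

definition refl :: "('v::real_vector \<Rightarrow> 'd \<Rightarrow> real) \<Rightarrow> ('v \<Rightarrow> 'd) \<Rightarrow> 'v \<Rightarrow> 'v \<Rightarrow> 'v" where
  "refl pair coroot \<alpha> v = v - pair v (coroot \<alpha>) *\<^sub>R \<alpha>"

definition corefl :: "('v \<Rightarrow> 'd::real_vector \<Rightarrow> real) \<Rightarrow> ('v \<Rightarrow> 'd) \<Rightarrow> 'v \<Rightarrow> 'd \<Rightarrow> 'd" where
  "corefl pair coroot \<alpha> l = l - pair \<alpha> l *\<^sub>R coroot \<alpha>"

text \<open>The set of coroots is \<open>coroot ` R\<close>. Neither integrality of the numbers \<open>pair \<alpha> (coroot \<beta>)\<close>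
  nor that \<open>R\<close> spans is required.\<close>

locale reduced_root_system =
  fixes pair :: "'v::real_vector \<Rightarrow> 'd::real_vector \<Rightarrow> real"
    and R :: "'v set"
    and coroot :: "'v \<Rightarrow> 'd"
    and \<Delta> :: "'v set"
  assumes finite_dim_V: "\<exists>B::'v set. finite B \<and> span B = UNIV"
    and finite_dim_dual: "\<exists>B::'d set. finite B \<and> span B = UNIV"
    and linear_left: "linear (\<lambda>v. pair v l)"
    and linear_right: "linear (pair v)"
    and perfect_left: "linear f \<Longrightarrow> \<exists>!l. \<forall>v. pair v l = f v"
    and perfect_right: "linear g \<Longrightarrow> \<exists>!v. \<forall>l. pair v l = g l"
    and finite_roots: "finite R"
    and zero_not_root: "0 \<notin> R"
    and inj_coroot: "inj_on coroot R"
    and pair_coroot: "\<alpha> \<in> R \<Longrightarrow> pair \<alpha> (coroot \<alpha>) = 2"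
    and refl_roots: "\<alpha> \<in> R \<Longrightarrow> refl pair coroot \<alpha> ` R = R"
    and corefl_coroots: "\<alpha> \<in> R \<Longrightarrow> corefl pair coroot \<alpha> ` (coroot ` R) = coroot ` R"
    and reduced: "\<alpha> \<in> R \<Longrightarrow> c *\<^sub>R \<alpha> \<in> R \<Longrightarrow> c = 1 \<or> c = - 1"
    and simple_subset: "\<Delta> \<subseteq> R"
    and simple_independent: "independent \<Delta>"
    and simple_base: "\<alpha> \<in> R \<Longrightarrow> \<exists>c. \<alpha> = (\<Sum>\<beta>\<in>\<Delta>. c \<beta> *\<^sub>R \<beta>) \<and>
           ((\<forall>\<beta>\<in>\<Delta>. 0 \<le> c \<beta>) \<or> (\<forall>\<beta>\<in>\<Delta>. c \<beta> \<le> 0))"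
begin

text \<open>Reflections are involutions, so closing under composition gives the generated group.\<close>

inductive_set weyl :: "('v \<Rightarrow> 'v) set" where
  weyl_id: "id \<in> weyl"
| weyl_refl: "\<alpha> \<in> R \<Longrightarrow> w \<in> weyl \<Longrightarrow> refl pair coroot \<alpha> \<circ> w \<in> weyl"

text \<open>The contragredient action on \<open>'d\<close>, and its complex-linear extension.\<close>

definition dual_act :: "('v \<Rightarrow> 'v) \<Rightarrow> 'd \<Rightarrow> 'd" where
  "dual_act w l = (THE m. \<forall>v. pair v m = pair (inv w v) l)"

definition cdual_act :: "('v \<Rightarrow> 'v) \<Rightarrow> 'd cplxn \<Rightarrow> 'd cplxn" where
  "cdual_act w l = (dual_act w (fst l), dual_act w (snd l))"

text \<open>The symmetric algebra of the complexification of \<open>'v\<close>, realised as the algebra of complex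
  polynomial functions on the complexification of \<open>'d\<close>; an element \<open>\<omega>\<close> of degree one is the
  function \<open>cpair pair \<omega>\<close>.\<close>

inductive_set sym_alg :: "('d cplxn \<Rightarrow> complex) set" where
  sym_const: "(\<lambda>l. c) \<in> sym_alg"
| sym_vec: "cpair pair \<omega> \<in> sym_alg"
| sym_add: "a \<in> sym_alg \<Longrightarrow> b \<in> sym_alg \<Longrightarrow> (\<lambda>l. a l + b l) \<in> sym_alg"
| sym_mult: "a \<in> sym_alg \<Longrightarrow> b \<in> sym_alg \<Longrightarrow> (\<lambda>l. a l * b l) \<in> sym_alg"

definition sym_act :: "('v \<Rightarrow> 'v) \<Rightarrow> ('d cplxn \<Rightarrow> complex) \<Rightarrow> 'd cplxn \<Rightarrow> complex" where
  "sym_act w a = (\<lambda>l. a (cdual_act (inv w) l))"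

definition sym_inv :: "('d cplxn \<Rightarrow> complex) set" where
  "sym_inv = {a \<in> sym_alg. \<forall>w\<in>weyl. sym_act w a = a}"

definition weyl_orbit :: "'d cplxn \<Rightarrow> 'd cplxn set" where
  "weyl_orbit l = (\<lambda>w. cdual_act w l) ` weyl"

end


section \<open>Graded affine Hecke algebras\<close>

text \<open>In \<open>cross_relation\<close>, \<open>b\<close> is the quotient of \<open>a - s\<^sub>\<alpha>(a)\<close> by \<open>\<alpha>\<close> in the symmetric algebra.\<close>

locale graded_hecke_algebra = reduced_root_system pair R coroot \<Delta>
  for pair :: "'v::real_vector \<Rightarrow> 'd::real_vector \<Rightarrow> real"
    and R :: "'v set" and coroot :: "'v \<Rightarrow> 'd" and \<Delta> :: "'v set" +
  fixes k :: "'v \<Rightarrow> real"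
    and scaleH :: "complex \<Rightarrow> 'h::ring_1 \<Rightarrow> 'h"
    and t :: "('v \<Rightarrow> 'v) \<Rightarrow> 'h"
    and \<iota> :: "('d cplxn \<Rightarrow> complex) \<Rightarrow> 'h"
  assumes k_conj: "\<alpha> \<in> \<Delta> \<Longrightarrow> \<beta> \<in> \<Delta> \<Longrightarrow> w \<in> weyl \<Longrightarrow> w \<alpha> = \<beta> \<Longrightarrow> k \<alpha> = k \<beta>"
    and H_vector_space: "vector_space scaleH"
    and scaleH_mult_left: "scaleH c x * y = scaleH c (x * y)"
    and scaleH_mult_right: "x * scaleH c y = scaleH c (x * y)"
    and t_id: "t id = 1"
    and t_mult: "v \<in> weyl \<Longrightarrow> w \<in> weyl \<Longrightarrow> t (v \<circ> w) = t v * t w"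
    and \<iota>_const: "\<iota> (\<lambda>l. c) = scaleH c 1"
    and \<iota>_add: "a \<in> sym_alg \<Longrightarrow> b \<in> sym_alg \<Longrightarrow> \<iota> (\<lambda>l. a l + b l) = \<iota> a + \<iota> b"
    and \<iota>_mult: "a \<in> sym_alg \<Longrightarrow> b \<in> sym_alg \<Longrightarrow> \<iota> (\<lambda>l. a l * b l) = \<iota> a * \<iota> b"
    and pbw: "bij_betw (\<lambda>f. \<Sum>w\<in>weyl. t w * \<iota> (f w)) (weyl \<rightarrow>\<^sub>E sym_alg) UNIV"
    and cross_relation: "\<alpha> \<in> \<Delta> \<Longrightarrow> a \<in> sym_alg \<Longrightarrow> b \<in> sym_alg \<Longrightarrow>
          (\<forall>l. cpair pair (\<alpha>, 0) l * b l = a l - sym_act (refl pair coroot \<alpha>) a l) \<Longrightarrow>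
          \<iota> a * t (refl pair coroot \<alpha>) =
            t (refl pair coroot \<alpha>) * \<iota> (sym_act (refl pair coroot \<alpha>) a)
            + scaleH (complex_of_real (k \<alpha>)) (\<iota> b)"
begin

definition is_bullet :: "('h \<Rightarrow> 'h) \<Rightarrow> bool" where
  "is_bullet bul \<longleftrightarrow>
     bij bul \<and>
     (\<forall>x y. bul (x + y) = bul x + bul y) \<and>
     (\<forall>c x. bul (scaleH c x) = scaleH (cnj c) (bul x)) \<and>
     (\<forall>x y. bul (x * y) = bul y * bul x) \<and>
     (\<forall>w\<in>weyl. bul (t w) = t (inv w)) \<and>
     (\<forall>\<omega>. bul (\<iota> (cpair pair \<omega>)) = \<iota> (cpair pair (cconj \<omega>)))"

end


section \<open>Modules\<close>

locale graded_hecke_module = graded_hecke_algebra pair R coroot \<Delta> k scaleH t \<iota>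
  for pair :: "'v::real_vector \<Rightarrow> 'd::real_vector \<Rightarrow> real"
    and R :: "'v set" and coroot :: "'v \<Rightarrow> 'd" and \<Delta> :: "'v set"
    and k :: "'v \<Rightarrow> real"
    and scaleH :: "complex \<Rightarrow> 'h::ring_1 \<Rightarrow> 'h"
    and t :: "('v \<Rightarrow> 'v) \<Rightarrow> 'h"
    and \<iota> :: "('d cplxn \<Rightarrow> complex) \<Rightarrow> 'h" +
  fixes scaleX :: "complex \<Rightarrow> 'x::ab_group_add \<Rightarrow> 'x"
    and \<pi> :: "'h \<Rightarrow> 'x \<Rightarrow> 'x"
  assumes X_vector_space: "vector_space scaleX"
    and \<pi>_linear: "Vector_Spaces.linear scaleX scaleX (\<pi> h)"
    and \<pi>_add: "\<pi> (g + h) x = \<pi> g x + \<pi> h x"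
    and \<pi>_scale: "\<pi> (scaleH c h) x = scaleX c (\<pi> h x)"
    and \<pi>_one: "\<pi> 1 x = x"
    and \<pi>_mult: "\<pi> (g * h) x = \<pi> g (\<pi> h x)"
begin

definition irreducible_module :: bool where
  "irreducible_module \<longleftrightarrow> (UNIV :: 'x set) \<noteq> {0} \<and>
     (\<forall>U. module.subspace scaleX U \<and> (\<forall>h. \<pi> h ` U \<subseteq> U) \<longrightarrow> U = {0} \<or> U = UNIV)"

definition weights :: "'d cplxn set" where
  "weights = {l. \<exists>x. x \<noteq> 0 \<and>
     (\<forall>a\<in>sym_alg. \<exists>n. ((\<lambda>y. \<pi> (\<iota> a) y - scaleX (a l) y) ^^ n) x = 0)}"

text \<open>Temperedness is meant for irreducible modules only.\<close>

definition tempered :: bool where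
  "tempered \<longleftrightarrow> (\<forall>l\<in>weights. \<forall>\<omega>. (\<forall>\<alpha>\<in>\<Delta>. 0 < pair \<omega> (coroot \<alpha>)) \<longrightarrow> pair \<omega> (fst l) \<le> 0)"

definition has_central_character :: "'d cplxn set \<Rightarrow> bool" where
  "has_central_character C \<longleftrightarrow> (\<exists>l. C = weyl_orbit l \<and>
     (\<forall>z\<in>sym_inv. \<forall>x. \<pi> (\<iota> z) x = scaleX (z l) x))"

definition has_real_central_character :: bool where
  "has_real_central_character \<longleftrightarrow> (\<exists>C. has_central_character C \<and> C \<subseteq> {l. snd l = 0})"

definition invariant_form :: "('h \<Rightarrow> 'h) \<Rightarrow> ('x \<Rightarrow> 'x \<Rightarrow> complex) \<Rightarrow> bool" where
  "invariant_form bul form \<longleftrightarrow> (\<forall>h x y. form (\<pi> h x) y = form x (\<pi> (bul h) y))"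

end

definition hermitian_form :: "(complex \<Rightarrow> 'x::ab_group_add \<Rightarrow> 'x) \<Rightarrow> ('x \<Rightarrow> 'x \<Rightarrow> complex) \<Rightarrow> bool" where
  "hermitian_form scaleX form \<longleftrightarrow>
     (\<forall>x x' y. form (x + x') y = form x y + form x' y) \<and>
     (\<forall>c x y. form (scaleX c x) y = c * form x y) \<and>
     (\<forall>x y. form y x = cnj (form x y))"

definition nondegenerate_form :: "('x::zero \<Rightarrow> 'x \<Rightarrow> complex) \<Rightarrow> bool" where
  "nondegenerate_form form \<longleftrightarrow> (\<forall>x. (\<forall>y. form x y = 0) \<longrightarrow> x = 0)"

end

theory Submission
  imports Defs "HOL-Computational_Algebra.Fundamental_Theorem_Algebra"
begin

text \<open>An irreducible module \<open>X\<close> with real central character carries a \<open>\<bullet>\<close>-invariant hermitian form as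
  soon as \<open>tr \<pi>(h\<^sup>\<bullet>)\<close> is the complex conjugate of \<open>tr \<pi>(h)\<close> for all \<open>h\<close>; this says that \<open>X\<close> and
  its hermitian dual have the same character, and the form is written down directly in
  \<open>invariant_hermitian_form_exists\<close>, using that \<open>\<pi>\<close> maps onto all operators (\<open>burnside\<close>).

  The difference \<open>D\<close> of the two traces is a trace functional, that is, \<open>D(gh) = D(hg)\<close>, so only the
  quotient of the algebra by commutators matters. By \<open>trace_functional_zero\<close> this quotient is
  spanned by the elements \<open>t\<^sub>w v\<^sub>1 \<dots> v\<^sub>n\<close> in which \<open>w\<close> lies in the parabolic subgroup generated by the
  reflections in some simple roots and the real vectors \<open>v\<^sub>i\<close> are orthogonal to the coroots of those
  simple roots. The geometric input is \<open>conjugate_elliptic_in_parabolic\<close>: every \<open>w\<close> is conjugate to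
  an element of a standard parabolic subgroup that has no more fixed vectors than the whole
  subgroup.

  In such an element \<open>t\<^sub>w\<close> commutes with every \<open>v\<^sub>i\<close>, so on \<open>X\<close> all these operators can be made
  triangular at once. The diagonal entries of \<open>t\<^sub>w\<close> are roots of unity, and those of the \<open>v\<^sub>i\<close> are
  real because the central character is real. Passing from \<open>t\<^sub>w v\<^sub>1 \<dots> v\<^sub>n\<close> to its image under \<open>\<bullet>\<close>
  replaces \<open>t\<^sub>w\<close> by its inverse and hence conjugates every diagonal entry (\<open>trace_commuting\<close>).\<close>

section \<open>Traces and commuting operators\<close>

locale complex_vector_space = vector_space scale
  for scale :: "complex \<Rightarrow> 'b::ab_group_add \<Rightarrow> 'b" (infixr "*s" 75)
begin

lemma linear_imp_0: "Vector_Spaces.linear scale scale f \<Longrightarrow> f 0 = 0"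
proof -
  assume "Vector_Spaces.linear scale scale f"
  then interpret f: Vector_Spaces.linear scale scale f .
  show ?thesis by (rule f.zero)
qed

definition trace_wrt :: "'b set \<Rightarrow> ('b \<Rightarrow> 'b) \<Rightarrow> complex" where
  "trace_wrt B f = (\<Sum>b\<in>B. representation B (f b) b)"

lemma trace_wrt_comp_commute:
  assumes B: "independent B" "span B = UNIV" "finite B"
    and C: "independent C" "span C = UNIV" "finite C"
    and f: "Vector_Spaces.linear scale scale f" and g: "Vector_Spaces.linear scale scale g"
  shows "trace_wrt B (f \<circ> g) = trace_wrt C (g \<circ> f)"
proof -
  interpret f: Vector_Spaces.linear scale scale f by fact
  interpret g: Vector_Spaces.linear scale scale g by fact
  have 1: "representation B (f (g b)) b
      = (\<Sum>c\<in>C. representation C (g b) c * representation B (f c) b)" for b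
  proof -
    have "f (g b) = f (\<Sum>c\<in>C. representation C (g b) c *s c)"
      using C by (simp add: sum_representation_eq)
    also have "\<dots> = (\<Sum>c\<in>C. representation C (g b) c *s f c)"
      by (simp add: f.sum f.scale)
    finally show ?thesis
      using B by (simp add: representation_sum representation_scale)
  qed
  have 2: "representation C (g (f c)) c
      = (\<Sum>b\<in>B. representation B (f c) b * representation C (g b) c)" for c
  proof -
    have "g (f c) = g (\<Sum>b\<in>B. representation B (f c) b *s b)"
      using B by (simp add: sum_representation_eq)
    also have "\<dots> = (\<Sum>b\<in>B. representation B (f c) b *s g b)"
      by (simp add: g.sum g.scale)
    finally show ?thesis
      using C by (simp add: representation_sum representation_scale)
  qed
  show ?thesis
    unfolding trace_wrt_def comp_def 1 2
    by (subst sum.swap) (simp add: mult.commute)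
qed

corollary trace_wrt_independent:
  assumes "independent B" "span B = UNIV" "finite B"
    and "independent C" "span C = UNIV" "finite C"
    and "Vector_Spaces.linear scale scale f"
  shows "trace_wrt B f = trace_wrt C f"
  using trace_wrt_comp_commute[OF assms(1-7), of "\<lambda>x. x"] linear_ident by (simp add: comp_def)

lemma trace_wrt_id:
  assumes "independent B"
  shows "trace_wrt B (\<lambda>x. x) = of_nat (card B)"
  using assms by (simp add: trace_wrt_def representation_basis)

lemma funpow_invariant: "f ` U \<subseteq> U \<Longrightarrow> v \<in> U \<Longrightarrow> (f ^^ n) v \<in> U"
  by (induction n) auto

definition poly_op :: "('b \<Rightarrow> 'b) \<Rightarrow> complex poly \<Rightarrow> 'b \<Rightarrow> 'b" where
  "poly_op f p v = (\<Sum>i\<le>degree p. coeff p i *s (f ^^ i) v)"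

lemma poly_op_altdef:
  assumes "degree p \<le> n"
  shows "poly_op f p v = (\<Sum>i\<le>n. coeff p i *s (f ^^ i) v)"
  unfolding poly_op_def using assms
  by (intro sum.mono_neutral_left) (auto simp: coeff_eq_0)

lemma poly_op_linear_factor:
  assumes "Vector_Spaces.linear scale scale f"
  shows "poly_op f ([:- r, 1:] * q) v = f (poly_op f q v) - r *s poly_op f q v"
proof -
  interpret f: Vector_Spaces.linear scale scale f by fact
  have eq: "[:- r, 1:] * q = pCons 0 q - smult r q"
    by simp
  have d: "degree ([:- r, 1:] * q) \<le> Suc (degree q)"
    using degree_mult_le[of "[:- r, 1:]" q] by simp
  have "poly_op f ([:- r, 1:] * q) v = (\<Sum>i\<le>Suc (degree q).
      coeff (pCons 0 q) i *s (f ^^ i) v - (r * coeff q i) *s (f ^^ i) v)"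
    unfolding poly_op_altdef[OF d] unfolding eq coeff_diff coeff_smult
    by (simp only: scale_left_diff_distrib)
  also have "\<dots> = (\<Sum>i\<le>Suc (degree q). coeff (pCons 0 q) i *s (f ^^ i) v)
      - (\<Sum>i\<le>Suc (degree q). (r * coeff q i) *s (f ^^ i) v)"
    by (rule sum_subtractf)
  also have "(\<Sum>i\<le>Suc (degree q). coeff (pCons 0 q) i *s (f ^^ i) v)
      = (\<Sum>i\<le>degree q. coeff q i *s f ((f ^^ i) v))"
    by (subst sum.atMost_Suc_shift) simp
  also have "\<dots> = f (poly_op f q v)"
    by (simp add: poly_op_def f.sum f.scale)
  also have "(\<Sum>i\<le>Suc (degree q). (r * coeff q i) *s (f ^^ i) v) = r *s poly_op f q v"
    by (simp only: poly_op_altdef[of q "Suc (degree q)", OF le_SucI[OF le_refl]] scale_sum_right scale_scale)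
  finally show ?thesis .
qed

text \<open>The powers of an operator applied to one vector satisfy a linear relation, because there are
  more of them than the dimension.\<close>

lemma annihilating_poly_exists:
  assumes F: "finite F" "span F = UNIV"
  shows "\<exists>p. p \<noteq> 0 \<and> poly_op f p v = 0"
proof (cases "inj_on (\<lambda>i. (f ^^ i) v) {..card F}")
  case True
  let ?S = "(\<lambda>i. (f ^^ i) v) ` {..card F}"
  have "card ?S = Suc (card F)"
    using True by (simp add: card_image)
  with independent_span_bound[OF F(1), of ?S] F(2) have "dependent ?S"
    by fastforce
  then obtain u where u: "\<exists>w\<in>?S. u w \<noteq> 0" "(\<Sum>w\<in>?S. u w *s w) = 0"
    by (subst (asm) dependent_finite) auto
  define p where "p = (\<Sum>i\<le>card F. monom (u ((f ^^ i) v)) i)"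
  have cf: "coeff p i = (if i \<le> card F then u ((f ^^ i) v) else 0)" for i
    by (auto simp: p_def coeff_sum)
  have "p \<noteq> 0"
    using u(1) cf by (metis (no_types, lifting) atMost_iff coeff_0 imageE)
  moreover have "degree p \<le> card F"
    by (rule degree_le) (simp add: cf)
  then have "poly_op f p v = (\<Sum>i\<le>card F. u ((f ^^ i) v) *s (f ^^ i) v)"
    by (simp add: poly_op_altdef cf)
  with u(2) have "poly_op f p v = 0"
    using True by (simp add: sum.reindex)
  ultimately show ?thesis by blast
next
  case False
  then obtain i j where ij: "(f ^^ i) v = (f ^^ j) v" "i \<noteq> j"
    by (auto simp: inj_on_def)
  define p where "p = monom (1::complex) i - monom 1 j"
  have cf: "coeff p n = (if n = i then 1 else 0) - (if n = j then 1 else 0)" for n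
    by (simp add: p_def)
  have "p \<noteq> 0"
    using cf[of i] ij(2) by auto
  have "degree p \<le> i + j"
    by (rule degree_le) (simp add: cf)
  then have "poly_op f p v = (\<Sum>n\<le>i + j. coeff p n *s (f ^^ n) v)"
    by (rule poly_op_altdef)
  also have "\<dots> = (\<Sum>n\<le>i + j. (if n = i then (f ^^ n) v else 0) - (if n = j then (f ^^ n) v else 0))"
    by (rule sum.cong) (auto simp: cf)
  also have "\<dots> = 0"
    by (simp add: sum_subtractf ij(1))
  finally show ?thesis using \<open>p \<noteq> 0\<close> by blast
qed


text \<open>An eigenvector of the operator induced on \<open>U'/U\<close>, written with representatives so that no
  quotient space is needed: among the polynomials \<open>p\<close> with \<open>p(f) v \<in> U\<close> one of least degree
  is not constant, and dividing it by a linear factor yields the eigenvector.\<close>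

lemma eigenvector_modulo:
  assumes F: "finite F" "span F = UNIV"
    and f: "Vector_Spaces.linear scale scale f"
    and U: "subspace U" and U': "subspace U'" "f ` U' \<subseteq> U'"
    and v: "v \<in> U'" "v \<notin> U"
  shows "\<exists>w r. w \<in> U' \<and> w \<notin> U \<and> f w - r *s w \<in> U"
proof -
  define P where "P n \<longleftrightarrow> (\<exists>p. p \<noteq> 0 \<and> degree p = n \<and> poly_op f p v \<in> U)" for n
  have "\<exists>n. P n"
    using annihilating_poly_exists[OF F, of f v] subspace_0[OF U] unfolding P_def by metis
  then have "P (LEAST n. P n)" by (rule LeastI_ex)
  then obtain p where p: "p \<noteq> 0" "degree p = (LEAST n. P n)" "poly_op f p v \<in> U"
    unfolding P_def by blast
  have deg: "degree p \<noteq> 0"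
  proof
    assume d: "degree p = 0"
    then have c: "coeff p 0 \<noteq> 0" using p(1) by (metis leading_coeff_neq_0)
    have "coeff p 0 *s v \<in> U" using p(3) d by (simp add: poly_op_def)
    then have "inverse (coeff p 0) *s coeff p 0 *s v \<in> U" using U subspace_scale by blast
    with c v(2) show False by simp
  qed
  then obtain r where "poly p r = 0"
    using fundamental_theorem_of_algebra constant_degree by metis
  then obtain q where q: "p = [:- r, 1:] * q"
    using poly_eq_0_iff_dvd by (metis dvdE)
  have "q \<noteq> 0" using p(1) q by auto
  then have "degree q < degree p"
    unfolding q by (subst degree_mult_eq) auto
  then have "\<not> P (degree q)" using p(2) not_less_Least by metis
  then have "poly_op f q v \<notin> U" using \<open>q \<noteq> 0\<close> by (auto simp: P_def)
  moreover have "poly_op f q v \<in> U'"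
    unfolding poly_op_def using U' v(1)
    by (intro subspace_sum subspace_scale funpow_invariant) auto
  moreover have "f (poly_op f q v) - r *s poly_op f q v \<in> U"
    using p(3) poly_op_linear_factor[OF f] q by metis
  ultimately show ?thesis by blast
qed

text \<open>Induction on the family: the vectors that are already eigenvectors modulo \<open>U\<close> of the other
  operators, with fixed eigenvalues, form a subspace preserved by the next one.\<close>

lemma common_eigenvector_modulo:
  assumes F: "finite F" "span F = UNIV"
    and G: "finite G"
    and lin: "\<And>f. f \<in> G \<Longrightarrow> Vector_Spaces.linear scale scale f"
    and comm: "\<And>f g. f \<in> G \<Longrightarrow> g \<in> G \<Longrightarrow> f \<circ> g = g \<circ> f"
    and U: "subspace U" "\<And>f. f \<in> G \<Longrightarrow> f ` U \<subseteq> U"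
    and v: "v \<notin> U"
  shows "\<exists>w \<chi>. w \<notin> U \<and> (\<forall>f\<in>G. f w - \<chi> f *s w \<in> U)"
  using G lin comm U(2)
proof (induction G rule: finite_induct)
  case empty
  then show ?case using v by blast
next
  case (insert f G)
  then obtain w \<chi> where w: "w \<notin> U" "\<forall>g\<in>G. g w - \<chi> g *s w \<in> U"
    by (metis insertI2)
  define U' where "U' = {y. \<forall>g\<in>G. g y - \<chi> g *s y \<in> U}"
  have U': "subspace U'"
  proof (rule subspaceI)
    show "0 \<in> U'"
      unfolding U'_def
    proof safe
      fix g assume "g \<in> G"
      then have "g 0 = 0" using linear_imp_0 insert.prems(1) by blast
      then show "g 0 - \<chi> g *s 0 \<in> U" using U(1) by (simp add: subspace_0)
    qed
  next
    fix x y assume xy: "x \<in> U'" "y \<in> U'"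
    show "x + y \<in> U'"
      unfolding U'_def
    proof safe
      fix g assume g: "g \<in> G"
      interpret g: Vector_Spaces.linear scale scale g using insert.prems(1) g by blast
      have "g (x + y) - \<chi> g *s (x + y) = (g x - \<chi> g *s x) + (g y - \<chi> g *s y)"
        by (simp add: g.add scale_right_distrib)
      then show "g (x + y) - \<chi> g *s (x + y) \<in> U"
        using xy g U(1) by (auto simp: U'_def intro: subspace_add)
    qed
  next
    fix c x assume x: "x \<in> U'"
    show "c *s x \<in> U'"
      unfolding U'_def
    proof safe
      fix g assume g: "g \<in> G"
      interpret g: Vector_Spaces.linear scale scale g using insert.prems(1) g by blast
      have "g (c *s x) - \<chi> g *s c *s x = c *s (g x - \<chi> g *s x)"
        by (simp add: g.scale scale_right_diff_distrib scale_left_commute)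
      then show "g (c *s x) - \<chi> g *s c *s x \<in> U"
        using x g U(1) by (auto simp: U'_def intro: subspace_scale)
    qed
  qed
  interpret f: Vector_Spaces.linear scale scale f using insert.prems(1) by blast
  have "f ` U' \<subseteq> U'"
  proof safe
    fix x assume x: "x \<in> U'"
    show "f x \<in> U'"
      unfolding U'_def
    proof safe
      fix g assume g: "g \<in> G"
      have "g (f x) = f (g x)" using insert.prems(2)[of f g] g by (metis comp_apply insertCI)
      then have "g (f x) - \<chi> g *s f x = f (g x - \<chi> g *s x)"
        by (simp add: f.diff f.scale)
      then show "g (f x) - \<chi> g *s f x \<in> U"
        using x g insert.prems(3)[of f] by (auto simp: U'_def)
    qed
  qed
  moreover have "w \<in> U'" using w(2) by (simp add: U'_def)
  ultimately obtain y r where y: "y \<in> U'" "y \<notin> U" "f y - r *s y \<in> U"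
    using eigenvector_modulo[OF F insert.prems(1)[of f] U(1) U', of w] w(1) by auto
  have "\<forall>g\<in>insert f G. g y - (\<chi>(f := r)) g *s y \<in> U"
    using y insert.hyps(2) by (auto simp: U'_def)
  then show ?case using y(2) by blast
qed

text \<open>Simultaneous triangularization. The flag is recorded by an invariant subspace \<open>U\<close> for each
  basis vector \<open>b\<close>, namely the span of the basis vectors before \<open>b\<close>; all that matters for
  traces is that elements of \<open>U\<close> have \<open>b\<close>-coordinate zero.\<close>

lemma simultaneous_triangularization:
  assumes F: "finite F" "span F = UNIV"
    and G: "finite G"
    and lin: "\<And>f. f \<in> G \<Longrightarrow> Vector_Spaces.linear scale scale f"
    and comm: "\<And>f g. f \<in> G \<Longrightarrow> g \<in> G \<Longrightarrow> f \<circ> g = g \<circ> f"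
  obtains B where "finite B" "independent B" "span B = UNIV"
    "\<And>b. b \<in> B \<Longrightarrow> \<exists>U \<chi>. subspace U \<and> (\<forall>f\<in>G. f ` U \<subseteq> U) \<and>
        (\<forall>u\<in>U. representation B u b = 0) \<and> (\<forall>f\<in>G. f b - \<chi> f *s b \<in> U)"
proof -
  define flag where "flag B \<longleftrightarrow> finite B \<and> independent B \<and> (\<forall>f\<in>G. f ` span B \<subseteq> span B) \<and>
     (\<forall>b\<in>B. \<exists>U \<chi>. subspace U \<and> U \<subseteq> span B \<and> (\<forall>f\<in>G. f ` U \<subseteq> U) \<and>
        (\<forall>u\<in>U. representation B u b = 0) \<and> (\<forall>f\<in>G. f b - \<chi> f *s b \<in> U))" for B
  have z: "f ` {0} \<subseteq> {0}" if "f \<in> G" for f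
    using linear_imp_0[OF lin[OF that]] by blast
  have "flag {}"
    using z by (simp add: flag_def independent_empty)
  moreover have "card B \<le> card F" if "flag B" for B
    using that independent_span_bound[OF F(1), of B] F(2) by (simp add: flag_def)
  then have "\<forall>B. flag B \<longrightarrow> card B < Suc (card F)" by (auto simp: less_Suc_eq_le)
  ultimately obtain B where B: "flag B" and mx: "\<And>C. flag C \<Longrightarrow> card C \<le> card B"
    using ex_has_greatest_nat[of flag "{}" card "Suc (card F)"] by blast
  note B' = B[unfolded flag_def]
  note flagB = bspec[OF B'[THEN conjunct2, THEN conjunct2, THEN conjunct2]]
  have "span B = UNIV"
  proof (rule ccontr)
    assume "span B \<noteq> UNIV"
    then obtain v where "v \<notin> span B" by auto
    then obtain w \<chi> where w: "w \<notin> span B" "\<forall>f\<in>G. f w - \<chi> f *s w \<in> span B"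
      using common_eigenvector_modulo[OF F G lin comm, of "span B" v] B' by auto
    let ?C = "insert w B"
    have ind: "independent ?C" using w(1) B' by (simp add: independent_insertI)
    have rep: "representation ?C u = representation B u" if "u \<in> span B" for u
      using representation_extend[OF ind that] by auto
    have wB: "w \<notin> B" using w(1) span_base by blast
    have wr: "representation B u w = 0" for u
      using representation_ne_zero[of B u w] wB by blast
    have sub: "span B \<subseteq> span ?C" by (rule span_mono) auto
    have "\<exists>U \<chi>. subspace U \<and> U \<subseteq> span ?C \<and> (\<forall>f\<in>G. f ` U \<subseteq> U) \<and>
        (\<forall>u\<in>U. representation ?C u b = 0) \<and> (\<forall>f\<in>G. f b - \<chi> f *s b \<in> U)" if "b \<in> ?C" for b
    proof (cases "b = w")
      case True
      then show ?thesis
        using w(2) B' rep wr sub by (intro exI[of _ "span B"] exI[of _ \<chi>]) auto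
    next
      case False
      then have "b \<in> B" using that by simp
      from flagB[OF this] obtain U \<chi>' where U: "subspace U" "U \<subseteq> span B" "\<forall>f\<in>G. f ` U \<subseteq> U"
        "\<forall>u\<in>U. representation B u b = 0" "\<forall>f\<in>G. f b - \<chi>' f *s b \<in> U"
        by (elim exE conjE)
      then show ?thesis
        using rep sub by (intro exI[of _ U] exI[of _ \<chi>']) auto
    qed
    moreover have "f ` span ?C \<subseteq> span ?C" if f: "f \<in> G" for f
    proof -
      interpret f: Vector_Spaces.linear scale scale f using lin[OF f] .
      have "f ` ?C \<subseteq> span ?C"
      proof safe
        have "f w = (f w - \<chi> f *s w) + \<chi> f *s w" by simp
        then show "f w \<in> span ?C"
          using w(2) f sub span_base[of w ?C] span_add[of "f w - \<chi> f *s w" ?C "\<chi> f *s w"]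
            span_scale[of w ?C "\<chi> f"] by auto
      next
        fix b assume "b \<in> B"
        then have "f b \<in> span B" using B' f span_base[of b B] by blast
        then show "f b \<in> span ?C" using sub by blast
      qed
      then have "span (f ` ?C) \<subseteq> span ?C" by (rule span_minimal) (rule subspace_span)
      then show ?thesis by (simp only: f.span_image)
    qed
    ultimately have "flag ?C" using B' ind by (simp add: flag_def)
    with mx[of ?C] wB B' show False by simp
  qed
  show ?thesis
  proof (rule that[of B])
    show "span B = UNIV" by fact
  next
    show "finite B" "independent B" using B' by blast+
  next
    fix b assume "b \<in> B"
    then show "\<exists>U \<chi>. subspace U \<and> (\<forall>f\<in>G. f ` U \<subseteq> U) \<and>
        (\<forall>u\<in>U. representation B u b = 0) \<and> (\<forall>f\<in>G. f b - \<chi> f *s b \<in> U)"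
      using flagB by fast
  qed
qed

end

section \<open>Irreducible modules and invariant hermitian forms\<close>

locale complex_algebra_module = complex_vector_space scaleX
  for scaleX :: "complex \<Rightarrow> 'x::ab_group_add \<Rightarrow> 'x" (infixr "*x" 75) +
  fixes scaleH :: "complex \<Rightarrow> 'h::ring_1 \<Rightarrow> 'h"
    and \<pi> :: "'h \<Rightarrow> 'x \<Rightarrow> 'x"
  assumes act_linear: "Vector_Spaces.linear scaleX scaleX (\<pi> h)"
    and act_add: "\<pi> (g + h) x = \<pi> g x + \<pi> h x"
    and act_scale: "\<pi> (scaleH c h) x = c *x \<pi> h x"
    and act_one: "\<pi> 1 x = x"
    and act_mult: "\<pi> (g * h) x = \<pi> g (\<pi> h x)"
begin

lemma act_vec:
  shows act_vec_add: "\<pi> h (x + y) = \<pi> h x + \<pi> h y"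
    and act_vec_diff: "\<pi> h (x - y) = \<pi> h x - \<pi> h y"
    and act_vec_scale: "\<pi> h (c *x x) = c *x \<pi> h x"
    and act_vec_0: "\<pi> h 0 = 0"
proof -
  interpret f: Vector_Spaces.linear scaleX scaleX "\<pi> h" by (rule act_linear)
  show "\<pi> h (x + y) = \<pi> h x + \<pi> h y" "\<pi> h (x - y) = \<pi> h x - \<pi> h y"
    "\<pi> h (c *x x) = c *x \<pi> h x" "\<pi> h 0 = 0"
    by (simp_all add: f.add f.diff f.scale f.zero)
qed

lemma act_0: "\<pi> 0 x = 0"
  using act_add[of 0 0 x] by simp

lemma act_diff: "\<pi> (g - h) x = \<pi> g x - \<pi> h x"
  using act_add[of "g - h" h x] by (simp add: algebra_simps)

lemma act_sum: "\<pi> (sum f I) x = (\<Sum>i\<in>I. \<pi> (f i) x)"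
  by (induction I rule: infinite_finite_induct) (auto simp: act_0 act_add)

definition irreducible :: bool where
  "irreducible \<longleftrightarrow> (UNIV :: 'x set) \<noteq> {0} \<and>
     (\<forall>U. subspace U \<and> (\<forall>h. \<pi> h ` U \<subseteq> U) \<longrightarrow> U = {0} \<or> U = UNIV)"

lemma irreducible_submodule:
  assumes "irreducible" "subspace U" "\<And>h u. u \<in> U \<Longrightarrow> \<pi> h u \<in> U" "u \<in> U" "u \<noteq> 0"
  shows "U = UNIV"
proof -
  have "\<forall>h. \<pi> h ` U \<subseteq> U" using assms(3) by blast
  then have "U = {0} \<or> U = UNIV" using assms(1,2) unfolding irreducible_def by blast
  then show ?thesis using assms(4,5) by blast
qed

lemma irreducible_cyclic:
  assumes "irreducible" "x \<noteq> 0"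
  shows "\<exists>h. \<pi> h x = y"
proof -
  have "range (\<lambda>h. \<pi> h x) = UNIV"
  proof (rule irreducible_submodule[OF assms(1), where u = x])
    show "subspace (range (\<lambda>h. \<pi> h x))"
      by (rule subspaceI)
        (auto simp: act_add[symmetric] act_scale[symmetric] intro: range_eqI[of _ _ 0] act_0[symmetric])
    show "\<pi> h u \<in> range (\<lambda>h. \<pi> h x)" if "u \<in> range (\<lambda>h. \<pi> h x)" for h u
      using that by (auto simp: act_mult[symmetric])
    show "x \<in> range (\<lambda>h. \<pi> h x)" by (rule range_eqI[of _ _ 1]) (simp add: act_one)
  qed fact
  then show ?thesis by (metis rangeE UNIV_I)
qed

lemma schur:
  assumes F: "finite F" "span F = UNIV" and irr: "irreducible"
    and \<phi>: "Vector_Spaces.linear scaleX scaleX \<phi>" and comm: "\<And>h x. \<phi> (\<pi> h x) = \<pi> h (\<phi> x)"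
  shows "\<exists>c. \<forall>x. \<phi> x = c *x x"
proof -
  interpret \<phi>: Vector_Spaces.linear scaleX scaleX \<phi> by fact
  obtain v :: 'x where "v \<noteq> 0" using irr unfolding irreducible_def by blast
  then obtain w c where w: "w \<noteq> 0" "\<phi> w - c *x w = 0"
    using eigenvector_modulo[OF F \<phi>, of "{0}" UNIV v] subspace_UNIV by auto
  have "{x. \<phi> x = c *x x} = UNIV"
  proof (rule irreducible_submodule[OF irr, where u = w])
    show "subspace {x. \<phi> x = c *x x}"
      by (rule subspaceI) (auto simp: \<phi>.add \<phi>.scale \<phi>.zero scale_right_distrib scale_left_commute)
  qed (use w in \<open>auto simp: comm act_vec_scale\<close>)
  then show ?thesis by blast
qed

text \<open>Induction on \<open>S\<close>. If every \<open>h\<close> that kills \<open>s\<close> and \<open>S\<close> also kills \<open>x\<close>, then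
  \<open>\<pi> h s \<mapsto> \<pi> h x\<close>, for \<open>h\<close> killing \<open>S\<close>, is a well defined module endomorphism, hence a scalar
  \<open>c\<close>; so all \<open>h\<close> that kill \<open>S\<close> kill \<open>x - c s\<close>, and \<open>x - c s\<close> lies in the span of \<open>S\<close>.\<close>

lemma density:
  assumes F: "finite F" "span F = UNIV" and irr: "irreducible"
    and S: "finite S" "independent S" "x \<notin> span S"
  shows "\<exists>h. (\<forall>s\<in>S. \<pi> h s = 0) \<and> \<pi> h x \<noteq> 0"
  using S
proof (induction S arbitrary: x rule: finite_induct)
  case empty
  then show ?case by (intro exI[of _ 1]) (auto simp: act_one)
next
  case (insert s S)
  have ind: "independent S" "s \<notin> span S"
    using insert.prems(1) insert.hyps(2) by (auto simp: independent_insert)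
  define I where "I = {h. \<forall>s\<in>S. \<pi> h s = 0}"
  have I: "0 \<in> I" "\<And>g h. g \<in> I \<Longrightarrow> h \<in> I \<Longrightarrow> g + h \<in> I" "\<And>g h. g \<in> I \<Longrightarrow> h \<in> I \<Longrightarrow> g - h \<in> I"
    "\<And>c h. h \<in> I \<Longrightarrow> scaleH c h \<in> I" "\<And>g h. h \<in> I \<Longrightarrow> g * h \<in> I"
    by (auto simp: I_def act_0 act_add act_diff act_scale act_mult act_vec_0)
  obtain h0 where h0: "h0 \<in> I" "\<pi> h0 s \<noteq> 0"
    using insert.IH[OF ind] by (auto simp: I_def)
  have "(\<lambda>h. \<pi> h s) ` I = UNIV"
  proof (rule irreducible_submodule[OF irr, where u = "\<pi> h0 s"])
    show "subspace ((\<lambda>h. \<pi> h s) ` I)"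
    proof (rule subspaceI)
      show "0 \<in> (\<lambda>h. \<pi> h s) ` I" using I(1) by (rule rev_image_eqI) (simp add: act_0)
      show "u + v \<in> (\<lambda>h. \<pi> h s) ` I" if "u \<in> (\<lambda>h. \<pi> h s) ` I" "v \<in> (\<lambda>h. \<pi> h s) ` I" for u v
        using that I(2) by (auto simp: act_add[symmetric])
      show "c *x u \<in> (\<lambda>h. \<pi> h s) ` I" if "u \<in> (\<lambda>h. \<pi> h s) ` I" for u c
        using that I(4) by (auto simp: act_scale[symmetric])
    qed
    show "\<pi> h u \<in> (\<lambda>h. \<pi> h s) ` I" if "u \<in> (\<lambda>h. \<pi> h s) ` I" for h u
      using that I(5) by (auto simp: act_mult[symmetric])
  qed (use h0 in auto)
  then have ex: "\<exists>h\<in>I. \<pi> h s = y" for y by (metis (no_types, lifting) UNIV_I imageE)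
  show ?case
  proof (rule ccontr)
    assume "\<not> ?case"
    then have kill: "\<pi> h x = 0" if "h \<in> I" "\<pi> h s = 0" for h
      using that by (auto simp: I_def)
    define pick where "pick y = (SOME h. h \<in> I \<and> \<pi> h s = y)" for y
    have pick: "pick y \<in> I" "\<pi> (pick y) s = y" for y
      using someI_ex[of "\<lambda>h. h \<in> I \<and> \<pi> h s = y"] ex[of y] by (auto simp: pick_def)
    define \<phi> where "\<phi> y = \<pi> (pick y) x" for y
    have \<phi>: "\<phi> (\<pi> h s) = \<pi> h x" if "h \<in> I" for h
      using kill[of "pick (\<pi> h s) - h"] I(3) pick that by (simp add: \<phi>_def act_diff)
    have \<phi>_add: "\<phi> (u + v) = \<phi> u + \<phi> v" for u v
      using \<phi>[of "pick u + pick v"] I(2) pick by (simp add: act_add) (simp add: \<phi>_def)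
    have \<phi>_scale: "\<phi> (c *x u) = c *x \<phi> u" for c u
      using \<phi>[of "scaleH c (pick u)"] I(4) pick by (simp add: act_scale) (simp add: \<phi>_def)
    have \<phi>_act: "\<phi> (\<pi> h u) = \<pi> h (\<phi> u)" for h u
      using \<phi>[of "h * pick u"] I(5) pick by (simp add: act_mult) (simp add: \<phi>_def)
    have "Vector_Spaces.linear scaleX scaleX \<phi>"
      by unfold_locales (simp_all add: \<phi>_add \<phi>_scale)
    from schur[OF F irr this \<phi>_act] obtain c where c: "\<And>u. \<phi> u = c *x u" by blast
    have "\<pi> h (x - c *x s) = 0" if "h \<in> I" for h
      using \<phi>[OF that] by (simp add: c act_vec_diff act_vec_scale)
    then have "x - c *x s \<in> span S"
      using insert.IH[OF ind(1), of "x - c *x s"] by (auto simp: I_def)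
    then have "(x - c *x s) + c *x s \<in> span (insert s S)"
      by (intro span_add span_scale) (auto intro: span_base span_mono[THEN subsetD, of S])
    then show False using insert.prems(2) by simp
  qed
qed

text \<open>Density, applied to a basis, gives for each basis vector \<open>b\<close> an element that kills the other
  ones and not \<open>b\<close>; since \<open>X\<close> is cyclic it can be arranged to send \<open>b\<close> anywhere.\<close>

theorem burnside:
  assumes F: "finite F" "span F = UNIV" and irr: "irreducible"
    and f: "Vector_Spaces.linear scaleX scaleX f"
  shows "\<exists>h. \<forall>x. \<pi> h x = f x"
proof -
  obtain B where B: "independent B" "span B = UNIV"
    using basis_exists[of UNIV] by (metis top.extremum_uniqueI)
  have finB: "finite B" using independent_span_bound[OF F(1) B(1)] F(2) by simp
  have "\<exists>h. (\<forall>c\<in>B - {b}. \<pi> h c = 0) \<and> \<pi> h b = f b" if b: "b \<in> B" for b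
  proof -
    have "b \<notin> span (B - {b})" using B(1) b by (auto simp: dependent_def)
    moreover have "independent (B - {b})" using B(1) independent_mono by blast
    ultimately obtain h where h: "\<forall>c\<in>B - {b}. \<pi> h c = 0" "\<pi> h b \<noteq> 0"
      using density[OF F irr, of "B - {b}" b] finB by auto
    obtain g where "\<pi> g (\<pi> h b) = f b" using irreducible_cyclic[OF irr h(2)] by blast
    then show ?thesis using h(1) by (intro exI[of _ "g * h"]) (simp add: act_mult act_vec_0)
  qed
  then obtain H where H: "\<And>b c. b \<in> B \<Longrightarrow> c \<in> B \<Longrightarrow> \<pi> (H b) c = (if c = b then f b else 0)"
    by (metis DiffI singletonD)
  define h where "h = (\<Sum>b\<in>B. H b)"
  have on_B: "\<pi> h b = f b" if "b \<in> B" for b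
    using finB that by (simp add: h_def act_sum H)
  interpret f: Vector_Spaces.linear scaleX scaleX f by fact
  have "\<pi> h x = f x" for x
  proof -
    have "x \<in> span B" using B(2) by simp
    then show ?thesis
      by (induction rule: span_induct_alt) (auto simp: act_vec_0 act_vec_add act_vec_scale f.zero f.add f.scale on_B)
  qed
  then show ?thesis by blast
qed

text \<open>The form is \<open>\<langle>x, y\<rangle> = tr \<pi>(b(g\<^sub>y) g\<^sub>x)\<close>, where \<open>b\<close> is the involution and \<open>\<pi>(g\<^sub>x)\<close> is the
  operator \<open>z \<mapsto> f(z) x\<close> of rank one, for a suitable linear functional \<open>f\<close>. The trace condition says
  that \<open>(g, h) \<mapsto> tr \<pi>(b(h) g)\<close> is hermitian; in particular it depends only on \<open>\<pi>(g)\<close> and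
  \<open>\<pi>(h)\<close>. If all these forms vanished, then by polarization in \<open>f\<close> the trace form would vanish on
  all operators, although its value at the identity is the dimension.\<close>

theorem invariant_hermitian_form_exists:
  fixes bul :: "'h \<Rightarrow> 'h"
  assumes B: "finite B" "independent B" "span B = UNIV" and irr: "irreducible"
    and bul_mult: "\<And>g h. bul (g * h) = bul h * bul g"
    and bul_bul: "\<And>h. bul (bul h) = h"
    and tr_bul: "\<And>h. trace_wrt B (\<pi> (bul h)) = cnj (trace_wrt B (\<pi> h))"
  shows "\<exists>form. hermitian_form scaleX form \<and> nondegenerate_form form \<and>
           (\<forall>h x y. form (\<pi> h x) y = form x (\<pi> (bul h) y))"
proof -
  define tr where "tr h = trace_wrt B (\<pi> h)" for h
  define tf where "tf g h = tr (bul h * g)" for g h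
  have tr_add: "tr (g + h) = tr g + tr h" for g h
    using B by (simp add: tr_def trace_wrt_def act_add representation_add sum.distrib)
  have herm: "tf h g = cnj (tf g h)" for g h
    using tr_bul[of "bul h * g"] by (simp add: tf_def tr_def bul_mult bul_bul)
  have cong1: "tf g h = tf g' h" if "\<And>x. \<pi> g x = \<pi> g' x" for g g' h
    using that by (simp add: tf_def tr_def trace_wrt_def act_mult)
  have cong: "tf g h = tf g' h'" if "\<And>x. \<pi> g x = \<pi> g' x" "\<And>x. \<pi> h x = \<pi> h' x" for g g' h h'
    using cong1[OF that(1), of h] cong1[OF that(2), of g'] herm[of h g'] herm[of h' g'] by simp
  have add1: "tf g h = tf g1 h + tf g2 h" if "\<And>x. \<pi> g x = \<pi> g1 x + \<pi> g2 x" for g g1 g2 h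
    using cong1[of g "g1 + g2" h] that by (simp add: act_add tf_def distrib_left tr_add)
  have scale1: "tf g h = c * tf g' h" if "\<And>x. \<pi> g x = c *x \<pi> g' x" for g g' c h
    using that B by (simp add: tf_def tr_def act_mult act_vec_scale trace_wrt_def
        representation_scale sum_distrib_left)
  have add2: "tf h g = tf h g1 + tf h g2" if "\<And>x. \<pi> g x = \<pi> g1 x + \<pi> g2 x" for g g1 g2 h
    using add1[OF that, of h] herm[of h g] herm[of h g1] herm[of h g2] by simp
  have scale2: "tf h g = cnj c * tf h g'" if "\<And>x. \<pi> g x = c *x \<pi> g' x" for g g' c h
    using scale1[OF that, of h] herm[of h g] herm[of h g'] by simp
  have inv: "tf (a * g) h = tf g (bul a * h)" for a g h
    by (simp add: tf_def bul_mult bul_bul mult.assoc)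

  have rank1: "\<exists>h. \<forall>z. \<pi> h z = f z *x x" if f: "Vector_Spaces.linear scaleX (*) f" for f x
  proof -
    interpret f: Vector_Spaces.linear scaleX "(*)" f by fact
    have "Vector_Spaces.linear scaleX scaleX (\<lambda>z. f z *x x)"
      by unfold_locales (simp_all add: f.add f.scale scale_left_distrib)
    then show ?thesis using burnside[OF B(1,3) irr] by blast
  qed
  define E where "E x f = (SOME h. \<forall>z. \<pi> h z = f z *x x)" for x and f :: "'x \<Rightarrow> complex"
  have E: "\<pi> (E x f) z = f z *x x" if "Vector_Spaces.linear scaleX (*) f" for x f z
    using someI_ex[OF rank1[OF that, of x]] by (simp add: E_def)

  have "\<exists>f x y. Vector_Spaces.linear scaleX (*) f \<and> tf (E x f) (E y f) \<noteq> 0"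
  proof (rule ccontr)
    assume "\<not> ?thesis"
    then have zero: "tf (E x f) (E y f) = 0" if "Vector_Spaces.linear scaleX (*) f" for f x y
      using that by blast
    have polar: "tf (E x f) (E y f') = 0"
      if f: "Vector_Spaces.linear scaleX (*) f" and f': "Vector_Spaces.linear scaleX (*) f'"
      for f f' x y
    proof -
      \<comment> \<open>Expand the vanishing form of the functional \<open>f + c f'\<close>, and take \<open>c = 1\<close> and \<open>c = \<i>\<close>.\<close>
      have expand: "cnj c * tf (E x f) (E y f') + c * tf (E x f') (E y f) = 0" for c
      proof -
        interpret f: Vector_Spaces.linear scaleX "(*)" f by fact
        interpret f': Vector_Spaces.linear scaleX "(*)" f' by fact
        define fc where "fc z = f z + c * f' z" for z
        have fc: "Vector_Spaces.linear scaleX (*) fc"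
          by unfold_locales (simp_all add: fc_def f.add f.scale f'.add f'.scale distrib_left
              mult.left_commute)
        define G where "G u = scaleH c (E u f')" for u
        have G: "\<pi> (G u) z = c *x \<pi> (E u f') z" for u z
          by (simp add: G_def act_scale)
        have sum: "\<pi> (E u fc) z = \<pi> (E u f) z + \<pi> (G u) z" for u z
          by (simp add: E[OF fc] E[OF f] E[OF f'] G fc_def scale_left_distrib)
        have "0 = tf (E x fc) (E y fc)" by (rule zero[OF fc, symmetric])
        also have "\<dots> = tf (E x f) (E y f) + tf (E x f) (G y) + (tf (G x) (E y f) + tf (G x) (G y))"
          unfolding add1[OF sum] unfolding add2[OF sum] by (rule refl)
        also have "\<dots> = cnj c * tf (E x f) (E y f') + c * tf (E x f') (E y f)"
          by (simp add: scale1[OF G] scale2[OF G] zero[OF f] zero[OF f'])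
        finally show ?thesis by (rule sym)
      qed
      have "tf (E x f') (E y f) = - tf (E x f) (E y f')"
        using expand[of 1] by (simp add: eq_neg_iff_add_eq_0 add.commute)
      with expand[of \<i>] show ?thesis by simp
    qed
    define r where "r b z = representation B z b" for b z
    have r: "Vector_Spaces.linear scaleX (*) (r b)" for b
      unfolding r_def by (rule linear_representation[OF B(2,3)])
    have "\<pi> (\<Sum>b\<in>B. E b (r b)) z = \<pi> 1 z" for z
      using B by (simp add: act_sum E[OF r] act_one r_def sum_representation_eq)
    then have "tf 1 1 = tf (\<Sum>b\<in>B. E b (r b)) (\<Sum>b\<in>B. E b (r b))"
      by (intro cong) auto
    also have "\<dots> = (\<Sum>b\<in>B. \<Sum>c\<in>B. tf (E b (r b)) (E c (r c)))"
    proof -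
      have z: "tf 0 h = 0" for h using add1[of 0 0 0 h] by (simp add: act_0)
      have z': "tf h 0 = 0" for h using z[of h] herm[of h 0] by simp
      have "tf (\<Sum>b\<in>A. E b (r b)) h = (\<Sum>b\<in>A. tf (E b (r b)) h)" for A h
        by (induction A rule: infinite_finite_induct)
          (auto simp: z intro!: add1[THEN trans] act_add)
      moreover have "tf h (\<Sum>b\<in>A. E b (r b)) = (\<Sum>b\<in>A. tf h (E b (r b)))" for A h
        by (induction A rule: infinite_finite_induct)
          (auto simp: z' intro!: add2[THEN trans] act_add)
      ultimately show ?thesis by (subst sum.swap) simp
    qed
    also have "\<dots> = 0" using polar r by simp
    finally have "tr (bul 1) = 0" by (simp add: tf_def)
    then have "tr 1 = 0" using tr_bul[of 1] by (simp add: tr_def)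
    then have "B = {}"
      using trace_wrt_id[OF B(2)] B(1) by (simp add: tr_def act_one trace_wrt_def)
    then show False using B(3) irr by (simp add: irreducible_def)
  qed
  then obtain f x0 y0 where f: "Vector_Spaces.linear scaleX (*) f" and ne: "tf (E x0 f) (E y0 f) \<noteq> 0"
    by blast
  define form where "form x y = tf (E x f) (E y f)" for x y
  have form_add: "form (x + x') y = form x y + form x' y" for x x' y
    unfolding form_def by (rule add1) (simp add: E[OF f] scale_right_distrib)
  have form_scale: "form (c *x x) y = c * form x y" for c x y
    unfolding form_def by (rule scale1) (simp add: E[OF f] scale_left_commute)
  have form_herm: "form y x = cnj (form x y)" for x y
    unfolding form_def by (rule herm)
  have form_inv: "form (\<pi> h x) y = form x (\<pi> (bul h) y)" for h x y
  proof -
    have a: "\<pi> (E (\<pi> h x) f) z = \<pi> (h * E x f) z" for h x z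
      by (simp add: E[OF f] act_mult act_vec_scale)
    have "form (\<pi> h x) y = tf (h * E x f) (E y f)" unfolding form_def by (rule cong) (auto simp: a)
    also have "\<dots> = tf (E x f) (bul h * E y f)" by (rule inv)
    also have "\<dots> = form x (\<pi> (bul h) y)" unfolding form_def by (rule cong) (auto simp: a)
    finally show ?thesis .
  qed
  have "nondegenerate_form form"
    unfolding nondegenerate_form_def
  proof (intro allI impI, rule ccontr)
    fix x assume x: "\<forall>y. form x y = 0" "x \<noteq> 0"
    have "{x. \<forall>y. form x y = 0} = UNIV"
    proof (rule irreducible_submodule[OF irr, where u = x])
      show "subspace {x. \<forall>y. form x y = 0}"
      proof (rule subspaceI)
        have "form 0 y = 0" for y using form_add[of 0 0 y] by simp
        then show "0 \<in> {x. \<forall>y. form x y = 0}" by simp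
      qed (auto simp: form_add form_scale)
    qed (use x in \<open>auto simp: form_inv\<close>)
    then have "form x0 y0 = 0" by blast
    then show False using ne by (simp add: form_def)
  qed
  then show ?thesis
    using form_add form_scale form_herm form_inv unfolding hermitian_form_def by blast
qed

end

section \<open>Reflection groups and their parabolic subgroups\<close>

context reduced_root_system
begin

abbreviation s :: "'v \<Rightarrow> 'v \<Rightarrow> 'v" where "s \<equiv> refl pair coroot"

lemma pair_left:
  shows pair_add_left: "pair (u + v) l = pair u l + pair v l"
    and pair_diff_left: "pair (u - v) l = pair u l - pair v l"
    and pair_scale_left: "pair (c *\<^sub>R v) l = c * pair v l"
    and pair_minus_left: "pair (- v) l = - pair v l"
  using linear_add[OF linear_left] linear_diff[OF linear_left] linear_scale[OF linear_left]
    linear_neg[OF linear_left] by simp_all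

lemma pair_right:
  shows pair_diff_right: "pair v (l - m) = pair v l - pair v m"
    and pair_scale_right: "pair v (c *\<^sub>R l) = c * pair v l"
  using linear_diff[OF linear_right] linear_scale[OF linear_right] by simp_all

lemma s_linear: "linear (s \<alpha>)"
  by (rule linearI) (simp_all add: refl_def pair_left algebra_simps)

lemma s_self: "\<alpha> \<in> R \<Longrightarrow> s \<alpha> \<alpha> = - \<alpha>"
  by (simp add: refl_def pair_coroot algebra_simps scaleR_2)

lemma s_s: "\<alpha> \<in> R \<Longrightarrow> s \<alpha> (s \<alpha> v) = v"
  by (simp add: refl_def pair_coroot pair_left algebra_simps)

lemma s_root: "\<alpha> \<in> R \<Longrightarrow> \<beta> \<in> R \<Longrightarrow> s \<alpha> \<beta> \<in> R"
  using refl_roots by blast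

lemma finite_translates_zero:
  fixes x v :: 'v
  assumes "\<And>n::nat. x + real n *\<^sub>R v \<in> R"
  shows "v = 0"
proof (rule ccontr)
  assume "v \<noteq> 0"
  then have "inj (\<lambda>n::nat. x + real n *\<^sub>R v)" by (auto simp: inj_def)
  moreover have "finite (range (\<lambda>n::nat. x + real n *\<^sub>R v))"
    using assms finite_roots by (auto intro: finite_subset)
  ultimately show False using finite_imageD by blast
qed

text \<open>The vector \<open>m = s\<^sub>\<beta>(\<alpha>\<^sup>\<or>)\<close> is the coroot of some \<open>\<gamma>'\<close>, and it also defines a reflection along
  \<open>\<gamma> = s\<^sub>\<beta> \<alpha>\<close>. Two reflections along \<open>\<gamma>\<close>, as well as two reflections whose coroots agree on
  \<open>R\<close>, differ by a unipotent map that preserves the finite set \<open>R\<close>, and a nontrivial unipotent map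
  has infinite orbits. The first remark shows that \<open>m\<close> and \<open>\<gamma>\<^sup>\<or>\<close> agree on \<open>R\<close>, the second one
  that \<open>\<gamma>' = \<gamma>\<close>.\<close>

lemma coroot_s:
  assumes \<alpha>: "\<alpha> \<in> R" and \<beta>: "\<beta> \<in> R"
  shows "pair v (coroot (s \<beta> \<alpha>)) = pair (s \<beta> v) (coroot \<alpha>)"
proof -
  define \<gamma> where "\<gamma> = s \<beta> \<alpha>"
  define m where "m = corefl pair coroot \<beta> (coroot \<alpha>)"
  have \<gamma>: "\<gamma> \<in> R" using s_root \<alpha> \<beta> by (simp add: \<gamma>_def)
  have "m \<in> coroot ` R"
    using corefl_coroots[OF \<beta>] \<alpha> by (auto simp: m_def)
  then obtain \<gamma>' where \<gamma>': "\<gamma>' \<in> R" "m = coroot \<gamma>'" by blast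
  have m: "pair v m = pair (s \<beta> v) (coroot \<alpha>)" for v
    by (simp add: m_def corefl_def refl_def pair_right pair_left)
  have m\<gamma>: "pair \<gamma> m = 2" using s_s[OF \<beta>] pair_coroot[OF \<alpha>] by (simp add: m \<gamma>_def)
  have s': "v - pair v m *\<^sub>R \<gamma> = s \<beta> (s \<alpha> (s \<beta> v))" for v
  proof -
    have "s \<beta> (s \<alpha> (s \<beta> v)) = s \<beta> (s \<beta> v) - pair v m *\<^sub>R \<gamma>"
      using linear_diff[OF s_linear[of \<beta>]] linear_scale[OF s_linear[of \<beta>]]
      by (simp add: refl_def[of _ _ \<alpha>] m \<gamma>_def)
    then show ?thesis using s_s[OF \<beta>] by simp
  qed
  have agree: "pair v m = pair v (coroot \<gamma>)" if v: "v \<in> R" for v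
  proof -
    define f where "f v = pair v m - pair v (coroot \<gamma>)" for v
    have step: "v + f v *\<^sub>R \<gamma> \<in> R" if v: "v \<in> R" for v
    proof -
      have "s \<gamma> (s \<beta> (s \<alpha> (s \<beta> v))) = v + f v *\<^sub>R \<gamma>"
        unfolding s'[symmetric] using pair_coroot[OF \<gamma>]
        by (simp add: refl_def pair_left f_def algebra_simps) (simp flip: scaleR_add_left)
      moreover have "s \<gamma> (s \<beta> (s \<alpha> (s \<beta> v))) \<in> R"
        by (intro s_root \<alpha> \<beta> \<gamma> v)
      ultimately show ?thesis by simp
    qed
    have f\<gamma>: "f (v + c *\<^sub>R \<gamma>) = f v" for c
      using pair_coroot[OF \<gamma>] by (simp add: f_def pair_left m\<gamma>)
    have "v + real n *\<^sub>R f v *\<^sub>R \<gamma> \<in> R" for n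
    proof (induction n)
      case (Suc n)
      show ?case
        using step[OF Suc] f\<gamma>[of "real n * f v"] by (simp add: algebra_simps)
    qed (simp add: v)
    then have "f v *\<^sub>R \<gamma> = 0" by (rule finite_translates_zero)
    then show ?thesis using \<gamma> zero_not_root by (auto simp: f_def)
  qed
  have "\<gamma> = \<gamma>'"
  proof -
    have p: "pair \<gamma>' m = 2" "pair \<gamma>' (coroot \<gamma>) = 2"
      using pair_coroot[OF \<gamma>'(1)] \<gamma>' agree[of \<gamma>'] by simp_all
    have "\<gamma> + real n *\<^sub>R (2 *\<^sub>R (\<gamma> - \<gamma>')) \<in> R" for n
    proof (induction n)
      case (Suc n)
      let ?v = "\<gamma> + real n *\<^sub>R (2 *\<^sub>R (\<gamma> - \<gamma>'))"
      have "pair ?v m = 2" using p m\<gamma> by (simp add: pair_left)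
      then have "s \<gamma>' ?v = ?v - 2 *\<^sub>R \<gamma>'" using \<gamma>'(2) by (simp add: refl_def)
      moreover have "pair (?v - 2 *\<^sub>R \<gamma>') (coroot \<gamma>) = - 2"
        using p pair_coroot[OF \<gamma>] by (simp add: pair_left)
      then have "s \<gamma> (?v - 2 *\<^sub>R \<gamma>') = ?v - 2 *\<^sub>R \<gamma>' + 2 *\<^sub>R \<gamma>"
        by (simp only: refl_def[of _ _ \<gamma>] scaleR_minus_left diff_minus_eq_add)
      ultimately have "s \<gamma> (s \<gamma>' ?v) = ?v - 2 *\<^sub>R \<gamma>' + 2 *\<^sub>R \<gamma>" by (simp only:)
      also have "\<dots> = \<gamma> + real (Suc n) *\<^sub>R (2 *\<^sub>R (\<gamma> - \<gamma>'))" by (simp add: algebra_simps)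
      finally show ?case using s_root[OF \<gamma> s_root[OF \<gamma>'(1) Suc]] by simp
    qed (simp add: \<gamma>)
    then have "2 *\<^sub>R (\<gamma> - \<gamma>') = 0" by (rule finite_translates_zero)
    then show ?thesis by simp
  qed
  then show ?thesis using \<gamma>' m by (simp add: \<gamma>_def)
qed

text \<open>Hence \<open>s\<^sub>\<beta>\<close> conjugates the reflection in \<open>\<alpha>\<close> to the reflection in \<open>s\<^sub>\<beta> \<alpha>\<close>.\<close>

lemma s_conj:
  assumes "\<alpha> \<in> R" "\<beta> \<in> R"
  shows "s (s \<beta> \<alpha>) (s \<beta> v) = s \<beta> (s \<alpha> v)"
  using coroot_s[OF assms, of "s \<beta> v"] s_s[OF assms(2), of v]
    linear_diff[OF s_linear[of \<beta>]] linear_scale[OF s_linear[of \<beta>]]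
  by (simp add: refl_def[of _ _ "s \<beta> \<alpha>"] refl_def[of _ _ \<alpha>])

text \<open>Every root is a combination of simple roots with coefficients of one sign, so the sign of this
  functional separates positive from negative roots.\<close>

definition height :: "'v \<Rightarrow> real" where
  "height = (SOME g. linear g \<and> (\<forall>\<alpha>\<in>\<Delta>. g \<alpha> = 1))"

lemma height: "linear height" "\<alpha> \<in> \<Delta> \<Longrightarrow> height \<alpha> = 1"
proof -
  have "\<exists>g::'v \<Rightarrow> real. linear g \<and> (\<forall>\<alpha>\<in>\<Delta>. g \<alpha> = (\<lambda>_. 1) \<alpha>)"
    by (rule linear_independent_extend[OF simple_independent])
  then have "linear height \<and> (\<forall>\<alpha>\<in>\<Delta>. height \<alpha> = 1)"
    unfolding height_def by (intro someI_ex[where P = "\<lambda>g. linear g \<and> (\<forall>\<alpha>\<in>\<Delta>. g \<alpha> = 1)"]) auto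
  then show "linear height" "\<alpha> \<in> \<Delta> \<Longrightarrow> height \<alpha> = 1" by auto
qed

lemmas height_diff = linear_diff[OF height(1)]
  and height_scale = linear_scale[OF height(1)]
  and height_sum = linear_sum[OF height(1)]
  and height_neg = linear_neg[OF height(1)]

lemma finite_simple: "finite \<Delta>"
  using finite_subset[OF simple_subset finite_roots] .

lemma simple_root: "\<alpha> \<in> \<Delta> \<Longrightarrow> \<alpha> \<in> R"
  using simple_subset by blast

lemma height_simple_sum: "height (\<Sum>\<beta>\<in>\<Delta>. c \<beta> *\<^sub>R \<beta>) = (\<Sum>\<beta>\<in>\<Delta>. c \<beta>)"
  by (simp add: height_sum height_scale height)

lemma height_root_nonzero:
  assumes "\<alpha> \<in> R"
  shows "height \<alpha> \<noteq> 0"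
proof
  assume 0: "height \<alpha> = 0"
  obtain c where c: "\<alpha> = (\<Sum>\<beta>\<in>\<Delta>. c \<beta> *\<^sub>R \<beta>)" "(\<forall>\<beta>\<in>\<Delta>. 0 \<le> c \<beta>) \<or> (\<forall>\<beta>\<in>\<Delta>. c \<beta> \<le> 0)"
    using simple_base[OF assms] by blast
  have "(\<Sum>\<beta>\<in>\<Delta>. c \<beta>) = 0" using 0 c(1) height_simple_sum by simp
  then have "(\<Sum>\<beta>\<in>\<Delta>. c \<beta>) = 0 \<and> (\<Sum>\<beta>\<in>\<Delta>. - c \<beta>) = 0" by (simp add: sum_negf)
  with c(2) have "\<forall>\<beta>\<in>\<Delta>. c \<beta> = 0"
    using sum_nonneg_eq_0_iff[OF finite_simple, of c]
      sum_nonneg_eq_0_iff[OF finite_simple, of "\<lambda>\<beta>. - c \<beta>"]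
    by (metis neg_0_le_iff_le neg_equal_0_iff_equal)
  then have "(\<Sum>\<beta>\<in>\<Delta>. c \<beta> *\<^sub>R \<beta>) = 0" by (intro sum.neutral) simp
  then have "\<alpha> = 0" by (simp only: c(1))
  then show False using assms zero_not_root by simp
qed

lemma positive_root:
  assumes "\<alpha> \<in> R" "height \<alpha> > 0"
  shows "\<exists>c. \<alpha> = (\<Sum>\<beta>\<in>\<Delta>. c \<beta> *\<^sub>R \<beta>) \<and> (\<forall>\<beta>\<in>\<Delta>. 0 \<le> c \<beta>)"
proof -
  obtain c where c: "\<alpha> = (\<Sum>\<beta>\<in>\<Delta>. c \<beta> *\<^sub>R \<beta>)" "(\<forall>\<beta>\<in>\<Delta>. 0 \<le> c \<beta>) \<or> (\<forall>\<beta>\<in>\<Delta>. c \<beta> \<le> 0)"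
    using simple_base[OF assms(1)] by blast
  moreover have "\<not> (\<forall>\<beta>\<in>\<Delta>. c \<beta> \<le> 0)"
    using assms(2) c(1) height_simple_sum sum_nonpos[of \<Delta> c] by force
  ultimately show ?thesis by blast
qed

text \<open>The reflection changes only the coefficient of \<open>\<beta>\<close>. If the sign of the root changes, all other
  coefficients vanish, and the only root that is a positive multiple of \<open>\<beta>\<close> is \<open>\<beta>\<close> itself.\<close>

lemma simple_reflection_sign:
  assumes \<beta>: "\<beta> \<in> \<Delta>" and \<delta>: "\<delta> \<in> R" "height \<delta> > 0" "height (s \<beta> \<delta>) < 0"
  shows "\<delta> = \<beta>"
proof -
  obtain c where c: "\<delta> = (\<Sum>\<gamma>\<in>\<Delta>. c \<gamma> *\<^sub>R \<gamma>)" "\<forall>\<gamma>\<in>\<Delta>. 0 \<le> c \<gamma>"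
    using positive_root[OF \<delta>(1,2)] by blast
  obtain d where d: "s \<beta> \<delta> = (\<Sum>\<gamma>\<in>\<Delta>. d \<gamma> *\<^sub>R \<gamma>)" "(\<forall>\<gamma>\<in>\<Delta>. 0 \<le> d \<gamma>) \<or> (\<forall>\<gamma>\<in>\<Delta>. d \<gamma> \<le> 0)"
    using simple_base[OF s_root[OF simple_root[OF \<beta>] \<delta>(1)]] by blast
  have d': "\<forall>\<gamma>\<in>\<Delta>. d \<gamma> \<le> 0"
    using \<delta>(3) d height_simple_sum sum_nonneg[of \<Delta> d] by force
  have c0: "c \<gamma> = 0" if \<gamma>: "\<gamma> \<in> \<Delta>" "\<gamma> \<noteq> \<beta>" for \<gamma>
  proof -
    obtain e :: "'v \<Rightarrow> real" where e: "linear e" "\<forall>\<alpha>\<in>\<Delta>. e \<alpha> = (if \<alpha> = \<gamma> then 1 else 0)"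
      using linear_independent_extend[OF simple_independent, of "\<lambda>\<alpha>. if \<alpha> = \<gamma> then 1 else 0"] by blast
    have es: "e (\<Sum>\<alpha>\<in>\<Delta>. a \<alpha> *\<^sub>R \<alpha>) = a \<gamma>" for a
    proof -
      have "e (\<Sum>\<alpha>\<in>\<Delta>. a \<alpha> *\<^sub>R \<alpha>) = (\<Sum>\<alpha>\<in>\<Delta>. if \<alpha> = \<gamma> then a \<alpha> else 0)"
        unfolding linear_sum[OF e(1)] using e(2)
        by (intro sum.cong) (auto simp: linear_scale[OF e(1)])
      then show ?thesis using finite_simple \<gamma>(1) by simp
    qed
    have "e (s \<beta> \<delta>) = e \<delta>"
      using e(2) \<beta> \<gamma> by (simp add: refl_def linear_diff[OF e(1)] linear_scale[OF e(1)])
    then have "c \<gamma> = d \<gamma>" using es[of c] es[of d] c(1) d(1) by simp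
    then show ?thesis using c(2) d' \<gamma>(1) by force
  qed
  have "\<delta> = (\<Sum>\<gamma>\<in>\<Delta>. if \<gamma> = \<beta> then c \<gamma> *\<^sub>R \<gamma> else 0)"
    unfolding c(1) using c0 by (intro sum.cong) auto
  then have \<delta>c: "\<delta> = c \<beta> *\<^sub>R \<beta>" using finite_simple \<beta> by simp
  then have "c \<beta> = 1 \<or> c \<beta> = - 1"
    using reduced[OF simple_root[OF \<beta>]] \<delta>(1) by simp
  then show ?thesis using \<delta>c c(2) \<beta> by force
qed

definition word :: "'v list \<Rightarrow> 'v \<Rightarrow> 'v" where
  "word as = foldr (\<lambda>\<alpha> f. s \<alpha> \<circ> f) as id"

lemma word_Nil [simp]: "word [] = id"
  and word_Cons [simp]: "word (\<alpha> # as) = s \<alpha> \<circ> word as"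
  by (simp_all add: word_def)

lemma word_append: "word (as @ bs) = word as \<circ> word bs"
  by (induction as) (auto simp: comp_assoc)

lemma word_linear: "linear (word as)"
proof (induction as)
  case (Cons \<alpha> as)
  then show ?case unfolding word_Cons by (rule linear_compose[OF _ s_linear])
qed (simp add: linear_id del: id_apply)

lemma word_root: "set as \<subseteq> R \<Longrightarrow> \<gamma> \<in> R \<Longrightarrow> word as \<gamma> \<in> R"
  by (induction as) (auto intro: s_root)

lemma word_weyl: "set as \<subseteq> R \<Longrightarrow> word as \<in> weyl"
  by (induction as) (auto intro: weyl.intros)

lemma word_rev: "set as \<subseteq> R \<Longrightarrow> word (rev as) (word as v) = v"
  by (induction as arbitrary: v) (auto simp: word_append s_s)

lemma word_rev': "set as \<subseteq> R \<Longrightarrow> word as (word (rev as) v) = v"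
  using word_rev[of "rev as"] by simp

lemma s_word:
  assumes "set as \<subseteq> R" "\<alpha> \<in> R"
  shows "s (word as \<alpha>) (word as v) = word as (s \<alpha> v)"
  using assms(1) by (induction as) (simp_all add: s_conj word_root assms(2))

text \<open>Apply the letters of the word to \<open>\<gamma>\<close> one by one from the right. At the step where the sign
  changes, the current root is the simple root of that letter.\<close>

lemma exchange:
  assumes "set as \<subseteq> \<Delta>" "\<gamma> \<in> R" "height \<gamma> > 0" "height (word as \<gamma>) < 0"
  shows "\<exists>bs \<beta> cs. as = bs @ \<beta> # cs \<and> word cs \<gamma> = \<beta>"
  using assms(1,4)
proof (induction as)
  case Nil
  then show ?case using assms(3) by simp
next
  case (Cons \<beta> as)
  have root: "word as \<gamma> \<in> R"
    using Cons.prems(1) assms(2) simple_subset by (intro word_root) auto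
  show ?case
  proof (cases "height (word as \<gamma>) < 0")
    case True
    then obtain bs \<beta>' cs where "as = bs @ \<beta>' # cs" "word cs \<gamma> = \<beta>'"
      using Cons by auto
    then show ?thesis by (metis append_Cons)
  next
    case False
    then have "word as \<gamma> = \<beta>"
      using simple_reflection_sign[of \<beta> "word as \<gamma>"] root height_root_nonzero[OF root] Cons.prems
      by auto
    then show ?thesis by (metis append_Nil)
  qed
qed

end

locale finite_weyl_root_system = reduced_root_system pair R coroot \<Delta>
  for pair :: "'v::real_vector \<Rightarrow> 'd::real_vector \<Rightarrow> real" and R coroot \<Delta> +
  assumes finite_weyl: "finite weyl"
begin

lemma finite_words: "J \<subseteq> \<Delta> \<Longrightarrow> finite {word as |as. set as \<subseteq> J}"
  using simple_subset by (intro finite_subset[OF _ finite_weyl]) (auto intro: word_weyl)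

text \<open>The sum of \<open>w \<gamma>\<close> over the group generated by the simple reflections vanishes, since for a
  simple root \<open>\<alpha>\<close> replacing \<open>w\<close> by \<open>w s\<^sub>\<alpha>\<close> changes the sign of \<open>w \<alpha>\<close>. So a positive root becomes
  negative under some word in simple reflections, and at the step where this happens it is a simple
  root.\<close>

lemma positive_root_conj_simple:
  assumes \<gamma>: "\<gamma> \<in> R" "height \<gamma> > 0"
  shows "\<exists>as. set as \<subseteq> \<Delta> \<and> word as \<gamma> \<in> \<Delta>"
proof -
  let ?W = "{word as |as. set as \<subseteq> \<Delta>}"
  have fin: "finite ?W" by (rule finite_words) simp
  have lin: "linear w" if "w \<in> ?W" for w using that word_linear by blast
  have simple0: "(\<Sum>w\<in>?W. w \<alpha>) = 0" if \<alpha>: "\<alpha> \<in> \<Delta>" for \<alpha>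
  proof -
    have inv: "w \<circ> s \<alpha> \<circ> s \<alpha> = w" for w :: "'v \<Rightarrow> 'v"
      using s_s[OF simple_root[OF \<alpha>]] by (auto simp: fun_eq_iff)
    have mem: "w \<circ> s \<alpha> \<in> ?W" if "w \<in> ?W" for w
    proof -
      from that obtain as where "w = word as" "set as \<subseteq> \<Delta>" by auto
      then have "w \<circ> s \<alpha> = word (as @ [\<alpha>])" "set (as @ [\<alpha>]) \<subseteq> \<Delta>"
        using \<alpha> by (auto simp: word_append)
      then show ?thesis by blast
    qed
    have "(\<Sum>w\<in>?W. w \<alpha>) = (\<Sum>w\<in>?W. (w \<circ> s \<alpha>) \<alpha>)"
      by (rule sum.reindex_bij_witness[of _ "\<lambda>w. w \<circ> s \<alpha>" "\<lambda>w. w \<circ> s \<alpha>"])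
        (use inv mem in auto)
    also have "\<dots> = (\<Sum>w\<in>?W. - w \<alpha>)"
      by (rule sum.cong) (use lin s_self[OF simple_root[OF \<alpha>]] in \<open>auto simp: linear_neg\<close>)
    also have "\<dots> = - (\<Sum>w\<in>?W. w \<alpha>)" by (rule sum_negf)
    finally have "2 *\<^sub>R (\<Sum>w\<in>?W. w \<alpha>) = 0" by (simp only: scaleR_2 eq_neg_iff_add_eq_0)
    then show ?thesis by simp
  qed
  obtain c where c: "\<gamma> = (\<Sum>\<beta>\<in>\<Delta>. c \<beta> *\<^sub>R \<beta>)" using positive_root[OF \<gamma>] by blast
  have "(\<Sum>w\<in>?W. w \<gamma>) = (\<Sum>w\<in>?W. \<Sum>\<beta>\<in>\<Delta>. c \<beta> *\<^sub>R w \<beta>)"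
    by (rule sum.cong) (use lin in \<open>auto simp: c linear_sum linear_scale\<close>)
  also have "\<dots> = (\<Sum>\<beta>\<in>\<Delta>. c \<beta> *\<^sub>R (\<Sum>w\<in>?W. w \<beta>))"
    by (subst sum.swap) (simp add: scaleR_right.sum)
  also have "\<dots> = 0" using simple0 by simp
  finally have sum0: "(\<Sum>w\<in>?W. height (w \<gamma>)) = 0"
    using height_sum[of "\<lambda>w. w \<gamma>" ?W] linear_0[OF height(1)] by simp
  have "\<exists>w\<in>?W. height (w \<gamma>) < 0"
  proof (rule ccontr)
    assume "\<not> ?thesis"
    moreover have "id \<in> ?W" by (auto intro!: exI[of _ "[]"])
    ultimately have "0 < (\<Sum>w\<in>?W. height (w \<gamma>))"
      using fin \<gamma>(2) by (intro sum_pos2[of _ id]) force+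
    then show False using sum0 by simp
  qed
  then obtain as where as: "set as \<subseteq> \<Delta>" "height (word as \<gamma>) < 0" by blast
  obtain bs \<beta> cs where "as = bs @ \<beta> # cs" "word cs \<gamma> = \<beta>"
    using exchange[OF as(1) \<gamma> as(2)] by blast
  then show ?thesis using as(1) by (intro exI[of _ cs]) auto
qed

lemma s_is_word:
  assumes \<gamma>: "\<gamma> \<in> R"
  shows "\<exists>as. set as \<subseteq> \<Delta> \<and> s \<gamma> = word as"
proof -
  have pos: "\<exists>as. set as \<subseteq> \<Delta> \<and> s \<gamma> = word as" if \<gamma>: "\<gamma> \<in> R" "height \<gamma> > 0" for \<gamma>
  proof -
    obtain as where as: "set as \<subseteq> \<Delta>" "word as \<gamma> \<in> \<Delta>"
      using positive_root_conj_simple[OF \<gamma>] by blast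
    have asR: "set as \<subseteq> R" using as(1) simple_subset by blast
    have "s \<gamma> v = word (rev as) (s (word as \<gamma>) (word as v))" for v
      using s_word[OF asR \<gamma>(1)] word_rev[OF asR] by simp
    then have "s \<gamma> = word (rev as @ word as \<gamma> # as)"
      by (auto simp: word_append)
    then show ?thesis using as by (intro exI[of _ "rev as @ word as \<gamma> # as"]) auto
  qed
  show ?thesis
  proof (cases "height \<gamma> > 0")
    case True
    then show ?thesis using pos \<gamma> by blast
  next
    case False
    have neg: "- \<gamma> \<in> R" using s_root[OF \<gamma> \<gamma>] s_self[OF \<gamma>] by simp
    have "height (- \<gamma>) > 0" using False height_root_nonzero[OF \<gamma>] by (simp add: height_neg)
    moreover have "s (- \<gamma>) = s \<gamma>"
    proof
      fix v
      show "s (- \<gamma>) v = s \<gamma> v"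
        using s_conj[OF \<gamma> \<gamma>, of "s \<gamma> v"] s_self[OF \<gamma>] s_s[OF \<gamma>] by simp
    qed
    ultimately show ?thesis using pos[OF neg] by simp
  qed
qed

lemma weyl_is_word:
  assumes "w \<in> weyl"
  shows "\<exists>as. set as \<subseteq> \<Delta> \<and> w = word as"
  using assms
proof (induction rule: weyl.induct)
  case weyl_id
  then show ?case by (intro exI[of _ "[]"]) auto
next
  case (weyl_refl \<alpha> w)
  then obtain as bs where "set as \<subseteq> \<Delta>" "s \<alpha> = word as" "set bs \<subseteq> \<Delta>" "w = word bs"
    using s_is_word by blast
  then show ?case by (intro exI[of _ "as @ bs"]) (auto simp: word_append)
qed

text \<open>A point of greatest height in the finite orbit is dominant, because
  \<open>s\<^sub>\<alpha> y = y - (y, \<alpha>\<^sup>\<or>) \<alpha>\<close> must not be higher than \<open>y\<close>.\<close>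

lemma dominant_conjugate:
  assumes "J \<subseteq> \<Delta>"
  shows "\<exists>as. set as \<subseteq> J \<and> (\<forall>\<alpha>\<in>J. pair (word as x) (coroot \<alpha>) \<ge> 0)"
proof -
  let ?W = "{word as |as. set as \<subseteq> J}"
  have "finite ?W" "?W \<noteq> {}" using finite_words[OF assms] by (auto intro!: exI[of _ "[]"])
  then have "Max ((\<lambda>u. height (u x)) ` ?W) \<in> (\<lambda>u. height (u x)) ` ?W"
    by (intro Max_in) auto
  then obtain w where w: "w \<in> ?W" and "Max ((\<lambda>u. height (u x)) ` ?W) = height (w x)" by blast
  then have w_max: "height (u x) \<le> height (w x)" if "u \<in> ?W" for u
    using Max_ge[of "(\<lambda>u. height (u x)) ` ?W" "height (u x)"] \<open>finite ?W\<close> that by auto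
  from w obtain as where as: "w = word as" "set as \<subseteq> J" by blast
  have "pair (w x) (coroot \<alpha>) \<ge> 0" if \<alpha>: "\<alpha> \<in> J" for \<alpha>
  proof -
    have "word (\<alpha> # as) \<in> ?W" using as(2) \<alpha> by (intro CollectI exI[of _ "\<alpha> # as"]) auto
    from w_max[OF this] have "height (s \<alpha> (w x)) \<le> height (w x)" by (simp add: as(1))
    moreover have "height \<alpha> = 1" using \<alpha> assms height(2) by blast
    ultimately show ?thesis by (simp add: refl_def height_diff height_scale)
  qed
  then show ?thesis using as by blast
qed

text \<open>If the last letter \<open>\<alpha>\<close> of a word \<open>w = u s\<^sub>\<alpha>\<close> satisfies \<open>u \<alpha> < 0\<close>, the exchange property
  shortens the word. Otherwise \<open>x - w x = (x - u x) + (x, \<alpha>\<^sup>\<or>) u \<alpha>\<close>, where both summands have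
  nonnegative height; so if the height is \<open>0\<close>, then \<open>\<alpha>\<close> is orthogonal to \<open>x\<close> and the induction
  hypothesis applies to \<open>u\<close>.\<close>

lemma dominant_stabilizer:
  assumes J: "J \<subseteq> \<Delta>" and dom: "\<And>\<alpha>. \<alpha> \<in> J \<Longrightarrow> pair x (coroot \<alpha>) \<ge> 0" and as: "set as \<subseteq> J"
  shows "height (x - word as x) \<ge> 0 \<and> (height (x - word as x) = 0 \<longrightarrow>
    (\<exists>bs. set bs \<subseteq> {\<alpha>\<in>J. pair x (coroot \<alpha>) = 0} \<and> word as = word bs))"
  using as
proof (induction as rule: length_induct)
  case (1 as)
  show ?case
  proof (cases as rule: rev_cases)
    case Nil
    then show ?thesis by (auto simp: linear_0[OF height(1)] intro!: exI[of _ "[]"])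
  next
    case (snoc us \<alpha>)
    have \<alpha>: "\<alpha> \<in> J" "\<alpha> \<in> \<Delta>" "\<alpha> \<in> R" and us: "set us \<subseteq> J" "set us \<subseteq> \<Delta>" "set us \<subseteq> R"
      using 1(2) snoc J simple_subset by auto
    have root: "word us \<alpha> \<in> R" using word_root us \<alpha> by blast
    show ?thesis
    proof (cases "height (word us \<alpha>) > 0")
      case True
      define c where "c = pair x (coroot \<alpha>)"
      have c: "c \<ge> 0" using dom \<alpha> by (simp add: c_def)
      have "word as x = word us x - c *\<^sub>R word us \<alpha>"
        by (simp add: snoc word_append refl_def c_def linear_diff[OF word_linear]
            linear_scale[OF word_linear])
      then have h: "height (x - word as x) = height (x - word us x) + c * height (word us \<alpha>)"
        by (simp add: height_diff height_scale)
      have IH: "height (x - word us x) \<ge> 0 \<and> (height (x - word us x) = 0 \<longrightarrow>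
          (\<exists>bs. set bs \<subseteq> {\<alpha>\<in>J. pair x (coroot \<alpha>) = 0} \<and> word us = word bs))"
        using 1(1) snoc us by simp
      have nonneg: "c * height (word us \<alpha>) \<ge> 0" using c True by simp
      show ?thesis
      proof (intro conjI impI)
        show "height (x - word as x) \<ge> 0" using h IH nonneg by simp
        assume "height (x - word as x) = 0"
        then have z: "height (x - word us x) = 0" "c * height (word us \<alpha>) = 0"
          using h IH nonneg by linarith+
        from z(2) True have "c = 0" by simp
        from z(1) IH obtain bs where
          "set bs \<subseteq> {\<alpha>\<in>J. pair x (coroot \<alpha>) = 0}" "word us = word bs" by blast
        then show "\<exists>bs. set bs \<subseteq> {\<alpha>\<in>J. pair x (coroot \<alpha>) = 0} \<and> word as = word bs"
          using \<open>c = 0\<close> \<alpha>(1) by (intro exI[of _ "bs @ [\<alpha>]"]) (auto simp: snoc word_append c_def)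
      qed
    next
      case False
      then have "height (word us \<alpha>) < 0" using height_root_nonzero[OF root] by simp
      then obtain bs \<beta> cs where e: "us = bs @ \<beta> # cs" "word cs \<alpha> = \<beta>"
        using exchange[OF us(2) \<alpha>(3)] height(2)[OF \<alpha>(2)] by auto
      have "set cs \<subseteq> R" using us(3) e by auto
      then have "s \<beta> (word cs (s \<alpha> v)) = word cs v" for v
        using s_word[of cs \<alpha> "s \<alpha> v"] \<alpha>(3) e(2) s_s by simp
      then have "word as = word (bs @ cs)"
        by (auto simp: snoc e(1) word_append fun_eq_iff)
      moreover have "length (bs @ cs) < length as" "set (bs @ cs) \<subseteq> J"
        using snoc e us by auto
      ultimately show ?thesis using 1(1)[rule_format, of "bs @ cs"] by simp
    qed
  qed
qed

text \<open>Take \<open>J\<close> of least cardinality. If \<open>x\<close> were fixed by the conjugate of \<open>w\<close> without being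
  orthogonal to \<open>J\<close>, then making \<open>x\<close> dominant for \<open>J\<close> would conjugate \<open>w\<close> into the stabilizer of
  \<open>x\<close>, which is generated by a proper subset of \<open>J\<close>.\<close>

theorem conjugate_elliptic_in_parabolic:
  assumes w: "w \<in> weyl"
  shows "\<exists>u as. u \<in> weyl \<and> set as \<subseteq> \<Delta> \<and> u \<circ> w = word as \<circ> u \<and>
    (\<forall>x. word as x = x \<longrightarrow> (\<forall>\<alpha>\<in>set as. pair x (coroot \<alpha>) = 0))"
proof -
  define P where "P J \<longleftrightarrow> J \<subseteq> \<Delta> \<and>
    (\<exists>bs as. set bs \<subseteq> \<Delta> \<and> set as \<subseteq> J \<and> word bs \<circ> w = word as \<circ> word bs)" for J
  obtain ws where "set ws \<subseteq> \<Delta>" "w = word ws" using weyl_is_word[OF w] by blast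
  then have "P \<Delta>"
    unfolding P_def by (intro conjI exI[of _ "[]"] exI[of _ ws]) auto
  then obtain J where J: "P J" and least: "\<And>K. P K \<Longrightarrow> card J \<le> card K"
    using ex_has_least_nat[of P \<Delta> card] by blast
  have J\<Delta>: "J \<subseteq> \<Delta>" using J by (simp add: P_def)
  obtain bs as where bs: "set bs \<subseteq> \<Delta>" and as: "set as \<subseteq> J" and conj: "word bs \<circ> w = word as \<circ> word bs"
    using J by (auto simp: P_def)
  have orth: "pair x (coroot \<alpha>) = 0" if x: "word as x = x" and \<alpha>: "\<alpha> \<in> J" for x \<alpha>
  proof -
    obtain cs where cs: "set cs \<subseteq> J" and dom: "\<And>\<alpha>. \<alpha> \<in> J \<Longrightarrow> pair (word cs x) (coroot \<alpha>) \<ge> 0"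
      using dominant_conjugate[OF J\<Delta>] by blast
    define y where "y = word cs x"
    define as' where "as' = cs @ as @ rev cs"
    have csR: "set cs \<subseteq> R" using cs J\<Delta> simple_subset by blast
    have fix_y: "word as' y = y"
      by (simp add: as'_def word_append y_def word_rev[OF csR] x)
    define K where "K = {\<alpha>\<in>J. pair y (coroot \<alpha>) = 0}"
    have "set as' \<subseteq> J" using cs as by (auto simp: as'_def)
    then have "height (y - word as' y) = 0 \<longrightarrow> (\<exists>ds. set ds \<subseteq> K \<and> word as' = word ds)"
      using dominant_stabilizer[OF J\<Delta>, of y as'] dom unfolding K_def y_def by blast
    then obtain ds where ds: "set ds \<subseteq> K" "word as' = word ds"
      using fix_y by (auto simp: linear_0[OF height(1)])
    have "word (cs @ bs) \<circ> w = word ds \<circ> word (cs @ bs)"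
    proof
      fix v
      have "word (cs @ bs) (w v) = word cs (word as (word bs v))"
        using fun_cong[OF conj, of v] by (simp add: word_append)
      also have "\<dots> = word as' (word (cs @ bs) v)"
        by (simp add: as'_def word_append word_rev[OF csR])
      finally show "(word (cs @ bs) \<circ> w) v = (word ds \<circ> word (cs @ bs)) v"
        by (simp add: ds(2))
    qed
    then have "P K"
      unfolding P_def using cs bs ds(1) J\<Delta>
      by (intro conjI exI[of _ "cs @ bs"] exI[of _ ds]) (auto simp: K_def)
    then have "card J \<le> card K" by (rule least)
    moreover have "finite J" using J\<Delta> finite_simple finite_subset by blast
    ultimately have "J \<subseteq> K" using card_seteq[of J K] by (auto simp: K_def)
    then have orth_y: "pair y (coroot \<beta>) = 0" if "\<beta> \<in> J" for \<beta> using that by (auto simp: K_def)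
    then have "s \<beta> y = y" if "\<beta> \<in> J" for \<beta> using that by (simp add: refl_def)
    then have "set es \<subseteq> J \<Longrightarrow> word es y = y" for es by (induction es) auto
    then have "word (rev cs) y = y" using cs by simp
    then have "x = y" using word_rev[OF csR, of x] by (simp add: y_def)
    then show ?thesis using orth_y \<alpha> by simp
  qed
  have "word bs \<in> weyl" using bs simple_subset by (intro word_weyl) blast
  then show ?thesis
    using as J\<Delta> conj orth by (intro exI[of _ "word bs"] exI[of _ as]) blast
qed

end

section \<open>The degree filtration of the graded Hecke algebra\<close>

context finite_weyl_root_system
begin

lemma weyl_word_inv:
  assumes "set as \<subseteq> \<Delta>"
  shows "inv (word as) = word (rev as)" "bij (word as)"
proof -
  have asR: "set as \<subseteq> R" using assms simple_subset by blast
  then show "inv (word as) = word (rev as)"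
    by (intro inv_equality) (simp_all add: word_rev word_rev')
  show "bij (word as)"
    by (rule o_bij[of "word (rev as)"]) (auto simp: fun_eq_iff word_rev[OF asR] word_rev'[OF asR])
qed

lemma weyl_linear: "w \<in> weyl \<Longrightarrow> linear w"
  using weyl_is_word word_linear by blast

lemma weyl_bij: "w \<in> weyl \<Longrightarrow> bij w"
  using weyl_is_word weyl_word_inv(2) by blast

lemma weyl_inv: "w \<in> weyl \<Longrightarrow> inv w \<in> weyl"
proof -
  assume "w \<in> weyl"
  then obtain as where as: "set as \<subseteq> \<Delta>" "w = word as" using weyl_is_word by blast
  then have "set (rev as) \<subseteq> R" using simple_subset by auto
  then show ?thesis using weyl_word_inv(1)[OF as(1)] as(2) word_weyl by simp
qed

lemma weyl_inv_simps:
  assumes "w \<in> weyl"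
  shows "w (inv w v) = v" "inv w (w v) = v" "w \<circ> inv w = id" "inv w \<circ> w = id" "inv (inv w) = w"
  using weyl_bij[OF assms]
  by (auto simp: bij_def surj_f_inv_f fun_eq_iff inv_inv_eq)

lemma weyl_comp: "u \<in> weyl \<Longrightarrow> w \<in> weyl \<Longrightarrow> u \<circ> w \<in> weyl"
  by (induction rule: weyl.induct) (auto simp: comp_assoc intro: weyl_refl)

lemma weyl_funpow: "w \<in> weyl \<Longrightarrow> w ^^ n \<in> weyl"
  by (induction n) (auto intro: weyl_comp weyl_id)

lemma weyl_finite_order:
  assumes w: "w \<in> weyl"
  shows "\<exists>n>0. w ^^ n = id"
proof -
  have "finite (range (\<lambda>n. w ^^ n))"
    using weyl_funpow[OF w] by (intro finite_subset[OF _ finite_weyl]) auto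
  then have "\<not> inj (\<lambda>n. w ^^ n)" using finite_imageD infinite_UNIV_nat by blast
  then obtain i j where ij: "w ^^ i = w ^^ j" "i < j"
    unfolding inj_def by (metis nat_neq_iff)
  have "w ^^ j = w ^^ i \<circ> w ^^ (j - i)"
    using ij(2) by (metis funpow_add le_add_diff_inverse less_imp_le)
  then have "(w ^^ i) ((w ^^ (j - i)) v) = (w ^^ i) v" for v
    using ij(1) by (metis comp_apply)
  then have "w ^^ (j - i) = id"
    using bij_is_inj[OF weyl_bij[OF weyl_funpow[OF w, of i]]] by (auto simp: fun_eq_iff dest: injD)
  then show ?thesis using ij(2) by (intro exI[of _ "j - i"]) auto
qed

lemma pair_dual_act:
  assumes "w \<in> weyl"
  shows "pair v (dual_act w l) = pair (inv w v) l"
proof -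
  have "linear (\<lambda>v. pair (inv w v) l)"
    using linear_compose[OF weyl_linear[OF weyl_inv[OF assms]] linear_left[of l]]
    by (simp add: comp_def)
  from perfect_left[OF this] have "\<exists>!m. \<forall>v. pair v m = pair (inv w v) l" .
  from theI'[OF this] show ?thesis unfolding dual_act_def by blast
qed

lemma cpair_dual_act:
  assumes "w \<in> weyl"
  shows "cpair pair (v, u) (cdual_act (inv w) l) = cpair pair (w v, w u) l"
  by (simp add: cpair_def cdual_act_def pair_dual_act[OF weyl_inv[OF assms]] weyl_inv_simps[OF assms])

lemma cpair_real: "cpair pair (v, 0) l = Complex (pair v (fst l)) (pair v (snd l))"
  using linear_0[OF linear_left] by (simp add: cpair_def)

end

context graded_hecke_algebra
begin

sublocale H: vector_space scaleH
  by (rule H_vector_space)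

sublocale finite_weyl_root_system pair R coroot \<Delta>
proof
  show "finite weyl"
  proof (rule ccontr)
    \<comment> \<open>Otherwise all sums in the basis property would be sums over an infinite set, hence zero.\<close>
    assume "\<not> finite weyl"
    then have "(\<lambda>f. \<Sum>w\<in>weyl. t w * \<iota> (f w)) ` (weyl \<rightarrow>\<^sub>E sym_alg) \<subseteq> {0}" by auto
    then have "(UNIV :: 'h set) \<subseteq> {0}" using bij_betw_imp_surj_on[OF pbw] by simp
    then show False by (metis UNIV_I singletonD subsetD zero_neq_one)
  qed
qed

definition vec :: "'v \<Rightarrow> 'h" where
  "vec v = \<iota> (cpair pair (v, 0))"

definition mon :: "'v list \<Rightarrow> 'h" where
  "mon vs = prod_list (map vec vs)"

lemma mon_simps [simp]: "mon [] = 1" "mon (v # vs) = vec v * mon vs" "mon (us @ vs) = mon us * mon vs"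
  by (simp_all add: mon_def)

lemma vec_add: "vec (u + v) = vec u + vec v"
proof -
  have "cpair pair (u + v, 0) = (\<lambda>l. cpair pair (u, 0) l + cpair pair (v, 0) l)"
    by (auto simp: cpair_real pair_left complex_eq_iff)
  then show ?thesis using \<iota>_add[OF sym_vec sym_vec] by (simp add: vec_def)
qed

lemma vec_scale: "vec (c *\<^sub>R v) = scaleH (complex_of_real c) (vec v)"
proof -
  have "cpair pair (c *\<^sub>R v, 0) = (\<lambda>l. complex_of_real c * cpair pair (v, 0) l)"
    by (auto simp: cpair_real pair_left complex_eq_iff)
  then have "vec (c *\<^sub>R v) = \<iota> (\<lambda>l. complex_of_real c) * \<iota> (cpair pair (v, 0))"
    using \<iota>_mult[OF sym_const sym_vec] by (simp add: vec_def)
  then show ?thesis by (simp add: vec_def \<iota>_const scaleH_mult_left)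
qed

lemma vec_commute: "vec u * vec v = vec v * vec u"
  unfolding vec_def by (simp flip: \<iota>_mult[OF sym_vec sym_vec] add: mult.commute)

lemma mon_commute_vec: "mon vs * vec v = vec v * mon vs"
  by (induction vs) (auto simp: mult.assoc, metis mult.assoc vec_commute)

lemma mon_commute_vec_left: "mon vs * (vec v * h) = vec v * (mon vs * h)"
  by (simp add: mult.assoc[symmetric] mon_commute_vec)

lemma vec_t_simple:
  assumes \<alpha>: "\<alpha> \<in> \<Delta>"
  shows "vec v * t (s \<alpha>) = t (s \<alpha>) * vec (s \<alpha> v)
    + scaleH (complex_of_real (k \<alpha> * pair v (coroot \<alpha>))) 1"
proof -
  have w: "s \<alpha> \<in> weyl" using weyl_refl[OF simple_root[OF \<alpha>] weyl_id] by simp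
  have act: "sym_act (s \<alpha>) (cpair pair (v, 0)) = cpair pair (s \<alpha> v, 0)"
    using cpair_dual_act[OF w] linear_0[OF s_linear] by (auto simp: sym_act_def)
  have "\<iota> (cpair pair (v, 0)) * t (s \<alpha>) = t (s \<alpha>) * \<iota> (sym_act (s \<alpha>) (cpair pair (v, 0)))
      + scaleH (complex_of_real (k \<alpha>)) (\<iota> (\<lambda>l. complex_of_real (pair v (coroot \<alpha>))))"
  proof (rule cross_relation[OF \<alpha> sym_vec sym_const], intro allI)
    fix l
    show "cpair pair (\<alpha>, 0) l * complex_of_real (pair v (coroot \<alpha>))
        = cpair pair (v, 0) l - sym_act (s \<alpha>) (cpair pair (v, 0)) l"
      unfolding act by (simp add: cpair_real refl_def pair_left complex_eq_iff)
  qed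
  then show ?thesis by (simp add: act vec_def \<iota>_const)
qed

lemma span_mult_left:
  assumes "\<And>x. x \<in> A \<Longrightarrow> g * x \<in> H.span C" "h \<in> H.span A"
  shows "g * h \<in> H.span C"
  using assms(2)
  by (induction rule: H.span_induct_alt)
    (auto simp: distrib_left scaleH_mult_right H.span_zero assms(1) intro!: H.span_add H.span_scale)

lemma span_mult_right:
  assumes "\<And>x. x \<in> A \<Longrightarrow> x * g \<in> H.span C" "h \<in> H.span A"
  shows "h * g \<in> H.span C"
  using assms(2)
  by (induction rule: H.span_induct_alt)
    (auto simp: distrib_right scaleH_mult_left H.span_zero assms(1) intro!: H.span_add H.span_scale)

lemma t_mult_span:
  assumes "w \<in> weyl" "q \<in> H.span (t ` weyl)"
  shows "t w * q \<in> H.span (t ` weyl)"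
  by (rule span_mult_left[OF _ assms(2)])
    (use assms(1) in \<open>auto simp: t_mult[symmetric] intro!: H.span_base weyl_comp\<close>)

text \<open>Iterating the cross relation along a word for \<open>w\<close>; each error term lies in the span of the
  \<open>t\<^sub>u\<close>.\<close>

lemma vec_t:
  assumes "w \<in> weyl"
  shows "\<exists>q\<in>H.span (t ` weyl). vec v * t w = t w * vec (inv w v) + q"
proof -
  have "set as \<subseteq> \<Delta> \<Longrightarrow> \<exists>q\<in>H.span (t ` weyl). vec v * t (word as) = t (word as) * vec (word (rev as) v) + q"
    for as
  proof (induction as arbitrary: v)
    case Nil
    then show ?case by (intro bexI[of _ 0]) (simp_all add: t_id H.span_zero del: id_apply, simp add: id_def)
  next
    case (Cons \<alpha> as)
    have \<alpha>: "\<alpha> \<in> \<Delta>" and as: "set as \<subseteq> R" using Cons.prems simple_subset by auto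
    have w: "s \<alpha> \<in> weyl" "word as \<in> weyl"
      using weyl_refl[OF simple_root[OF \<alpha>] weyl_id] word_weyl[OF as] by simp_all
    define c where "c = complex_of_real (k \<alpha> * pair v (coroot \<alpha>))"
    obtain q where q: "q \<in> H.span (t ` weyl)"
      "vec (s \<alpha> v) * t (word as) = t (word as) * vec (word (rev as) (s \<alpha> v)) + q"
      using Cons by auto
    have "vec v * t (word (\<alpha> # as)) = vec v * t (s \<alpha>) * t (word as)"
      by (simp add: t_mult[OF w] mult.assoc)
    also have "\<dots> = t (s \<alpha>) * (vec (s \<alpha> v) * t (word as)) + scaleH c (t (word as))"
      by (simp add: vec_t_simple[OF \<alpha>] c_def distrib_right scaleH_mult_left mult.assoc)
    also have "\<dots> = t (word (\<alpha> # as)) * vec (word (rev (\<alpha> # as)) v)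
        + (t (s \<alpha>) * q + scaleH c (t (word as)))"
      unfolding q(2) by (simp add: t_mult[OF w] mult.assoc distrib_left word_append add.assoc)
    finally have "vec v * t (word (\<alpha> # as)) = t (word (\<alpha> # as)) * vec (word (rev (\<alpha> # as)) v)
        + (t (s \<alpha>) * q + scaleH c (t (word as)))" .
    moreover have "t (s \<alpha>) * q + scaleH c (t (word as)) \<in> H.span (t ` weyl)"
      using w(2) by (intro H.span_add[OF t_mult_span[OF w(1) q(1)]] H.span_scale H.span_base imageI)
    ultimately show ?case by blast
  qed
  then show ?thesis using weyl_is_word[OF assms] weyl_word_inv(1) by metis
qed

text \<open>Degree counts the vector factors only, so that modulo lower degree the algebra behaves like the
  semidirect product of the Weyl group with the polynomial functions.\<close>

definition below_degree :: "nat \<Rightarrow> 'h set" where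
  "below_degree n = H.span {t w * mon vs |w vs. w \<in> weyl \<and> length vs < n}"

lemma t_below_degree:
  assumes u: "u \<in> weyl" and h: "h \<in> below_degree n"
  shows "t u * h \<in> below_degree n"
  unfolding below_degree_def
proof (rule span_mult_left[OF _ h[unfolded below_degree_def]])
  fix x assume "x \<in> {t w * mon vs |w vs. w \<in> weyl \<and> length vs < n}"
  then obtain w vs where x: "x = t w * mon vs" "w \<in> weyl" "length vs < n" by blast
  have "t u * x = t (u \<circ> w) * mon vs" by (simp add: x(1) t_mult[OF u x(2)] mult.assoc)
  then show "t u * x \<in> H.span {t w * mon vs |w vs. w \<in> weyl \<and> length vs < n}"
    using weyl_comp[OF u x(2)] x(3) by (auto intro!: H.span_base)
qed

lemma span_t_mon_below_degree:
  assumes "q \<in> H.span (t ` weyl)" "length vs < n"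
  shows "q * mon vs \<in> below_degree n"
  unfolding below_degree_def
  by (rule span_mult_right[OF _ assms(1)]) (use assms(2) in \<open>auto intro!: H.span_base\<close>)

lemma vec_below_degree:
  assumes h: "h \<in> below_degree n"
  shows "vec v * h \<in> below_degree (Suc n)"
  unfolding below_degree_def
proof (rule span_mult_left[OF _ h[unfolded below_degree_def]])
  fix x assume "x \<in> {t w * mon vs |w vs. w \<in> weyl \<and> length vs < n}"
  then obtain w vs where x: "x = t w * mon vs" "w \<in> weyl" "length vs < n" by blast
  obtain q where q: "q \<in> H.span (t ` weyl)" "vec v * t w = t w * vec (inv w v) + q"
    using vec_t[OF x(2)] by blast
  have "vec v * x = t w * mon (inv w v # vs) + q * mon vs"
    using q(2) by (simp add: x(1) mult.assoc[symmetric] distrib_right)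
  moreover have "q * mon vs \<in> below_degree (Suc n)"
    using span_t_mon_below_degree[OF q(1)] x(3) by simp
  moreover have "t w * mon (inv w v # vs) \<in> below_degree (Suc n)"
    unfolding below_degree_def using x(2,3)
    by (intro H.span_base CollectI exI[of _ w] exI[of _ "inv w v # vs"]) auto
  ultimately show "vec v * x \<in> H.span {t w * mon vs |w vs. w \<in> weyl \<and> length vs < Suc n}"
    unfolding below_degree_def by (simp add: H.span_add)
qed

lemma mon_t:
  assumes w: "w \<in> weyl"
  shows "\<exists>r\<in>below_degree (length vs). mon vs * t w = t w * mon (map (inv w) vs) + r"
proof (induction vs)
  case Nil
  then show ?case by (intro bexI[of _ 0]) (auto simp: below_degree_def H.span_zero)
next
  case (Cons v vs)
  then obtain r where r: "r \<in> below_degree (length vs)"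
    "mon vs * t w = t w * mon (map (inv w) vs) + r" by blast
  obtain q where q: "q \<in> H.span (t ` weyl)" "vec v * t w = t w * vec (inv w v) + q"
    using vec_t[OF w] by blast
  have "mon (v # vs) * t w = vec v * t w * mon (map (inv w) vs) + vec v * r"
    by (simp add: mult.assoc r(2) distrib_left)
  also have "\<dots> = t w * mon (map (inv w) (v # vs)) + (q * mon (map (inv w) vs) + vec v * r)"
    by (simp add: q(2) distrib_right mult.assoc add.assoc)
  finally have "mon (v # vs) * t w
      = t w * mon (map (inv w) (v # vs)) + (q * mon (map (inv w) vs) + vec v * r)" .
  moreover have "q * mon (map (inv w) vs) + vec v * r \<in> below_degree (length (v # vs))"
    using span_t_mon_below_degree[OF q(1), of "map (inv w) vs" "Suc (length vs)"]
      vec_below_degree[OF r(1), of v] by (simp add: below_degree_def H.span_add)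
  ultimately show ?case by blast
qed

lemma \<iota>_in_span_mon: "a \<in> sym_alg \<Longrightarrow> \<iota> a \<in> H.span (range mon)"
proof (induction rule: sym_alg.induct)
  case (sym_const c)
  have "scaleH c (mon []) \<in> H.span (range mon)" by (intro H.span_scale H.span_base) blast
  then show ?case by (simp add: \<iota>_const)
next
  case (sym_vec \<omega>)
  obtain u v where \<omega>: "\<omega> = (u, v)" by (cases \<omega>)
  have "cpair pair \<omega> = (\<lambda>l. cpair pair (u, 0) l + (\<lambda>l. \<i> * cpair pair (v, 0) l) l)"
    unfolding \<omega> cpair_real by (rule ext) (simp add: cpair_def complex_eq_iff)
  then have "\<iota> (cpair pair \<omega>) = \<iota> (cpair pair (u, 0)) + \<iota> (\<lambda>l. \<i> * cpair pair (v, 0) l)"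
    using \<iota>_add[OF sym_alg.sym_vec sym_alg.sym_mult[OF sym_alg.sym_const sym_alg.sym_vec]]
    by simp
  also have "\<dots> = mon [u] + scaleH \<i> (mon [v])"
    by (simp add: \<iota>_mult[OF sym_alg.sym_const sym_alg.sym_vec] \<iota>_const vec_def scaleH_mult_left)
  also have "\<dots> \<in> H.span (range mon)"
    by (intro H.span_add H.span_scale H.span_base rangeI)
  finally show ?case .
next
  case (sym_add a b)
  then show ?case by (simp add: \<iota>_add H.span_add[OF sym_add.IH])
next
  case (sym_mult a b)
  have "\<iota> a * \<iota> b \<in> H.span (range mon)"
  proof (rule span_mult_right[OF _ sym_mult.IH(1)])
    fix x assume "x \<in> range mon"
    then obtain us where x: "x = mon us" by blast
    show "x * \<iota> b \<in> H.span (range mon)"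
    proof (rule span_mult_left[OF _ sym_mult.IH(2)])
      fix y assume "y \<in> range mon"
      then obtain vs where "y = mon vs" by blast
      then have "x * y = mon (us @ vs)" by (simp add: x)
      then show "x * y \<in> H.span (range mon)" by (metis H.span_base rangeI)
    qed
  qed
  then show ?case by (simp add: \<iota>_mult sym_mult.hyps)
qed

lemma span_t_mon: "H.span {t w * mon vs |w vs. w \<in> weyl} = UNIV"
proof -
  have "h \<in> H.span {t w * mon vs |w vs. w \<in> weyl}" for h
  proof -
    have "h \<in> (\<lambda>f. \<Sum>w\<in>weyl. t w * \<iota> (f w)) ` (weyl \<rightarrow>\<^sub>E sym_alg)"
      using bij_betw_imp_surj_on[OF pbw] by simp
    then obtain f where f: "f \<in> weyl \<rightarrow>\<^sub>E sym_alg" "h = (\<Sum>w\<in>weyl. t w * \<iota> (f w))" by blast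
    have "t w * \<iota> (f w) \<in> H.span {t w * mon vs |w vs. w \<in> weyl}" if w: "w \<in> weyl" for w
    proof (rule span_mult_left[of "range mon"])
      show "\<iota> (f w) \<in> H.span (range mon)" using f(1) w by (intro \<iota>_in_span_mon) auto
    qed (use w in \<open>auto intro!: H.span_base\<close>)
    then show ?thesis unfolding f(2) by (rule H.span_sum)
  qed
  then show ?thesis by blast
qed

text \<open>Induction on the degree, modulo which \<open>t\<^sub>w\<close> moves past \<open>v\<close> as in a semidirect product. Cycling
  a factor \<open>v\<close> of the monomial around \<open>t\<^sub>w\<close> replaces it by \<open>w\<^sup>-\<^sup>1 v\<close>, so every factor may be
  replaced by its average over the powers of \<open>w\<close>, which is fixed by \<open>w\<close>. Conjugation then moves
  \<open>w\<close> into a parabolic subgroup whose simple roots are orthogonal to all vectors fixed by \<open>w\<close>.\<close>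

theorem trace_functional_zero:
  fixes D :: "'h \<Rightarrow> complex"
  assumes D_add: "\<And>g h. D (g + h) = D g + D h"
    and D_scale: "\<And>c h. D (scaleH c h) = c * D h"
    and D_comm: "\<And>g h. D (g * h) = D (h * g)"
    and D_parabolic: "\<And>as vs. set as \<subseteq> \<Delta> \<Longrightarrow> \<forall>v\<in>set vs. \<forall>\<alpha>\<in>set as. pair v (coroot \<alpha>) = 0 \<Longrightarrow>
      D (t (word as) * mon vs) = 0"
  shows "D h = 0"
proof -
  have D_span: "D h = 0" if "h \<in> H.span A" "\<And>x. x \<in> A \<Longrightarrow> D x = 0" for h A
    using that(1)
  proof (induction rule: H.span_induct_alt)
    case base
    show ?case using D_scale[of 0 0] by simp
  next
    case (step c x y)
    then show ?case using that(2) by (simp add: D_add D_scale)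
  qed
  have main: "w \<in> weyl \<Longrightarrow> D (t w * mon vs) = 0" for w vs
  proof (induction "length vs" arbitrary: w vs rule: less_induct)
    case less
    note w = less.prems
    define n where "n = length vs"
    have low: "D h = 0" if "h \<in> below_degree n" for h
      using that unfolding below_degree_def
      by (rule D_span) (use less.hyps in \<open>auto simp: n_def\<close>)
    have cycle: "D (t w * (vec v * mon us)) = D (t w * (vec (inv w v) * mon us))"
      if "length us < n" for v us
    proof -
      obtain q where q: "q \<in> H.span (t ` weyl)" "vec v * t w = t w * vec (inv w v) + q"
        using vec_t[OF w] by blast
      have "D (t w * (vec v * mon us)) = D ((t w * mon us) * vec v)"
        by (simp add: mon_commute_vec mult.assoc)
      also have "\<dots> = D ((vec v * t w) * mon us)" by (subst D_comm) (simp add: mult.assoc)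
      also have "\<dots> = D (t w * (vec (inv w v) * mon us)) + D (q * mon us)"
        by (simp add: q(2) distrib_right D_add mult.assoc)
      also have "D (q * mon us) = 0"
        by (rule low[OF span_t_mon_below_degree[OF q(1) that]])
      finally show ?thesis by simp
    qed
    obtain N where N: "N > 0" "inv w ^^ N = id" using weyl_finite_order[OF weyl_inv[OF w]] by blast
    define avg where "avg v = (1 / real N) *\<^sub>R (\<Sum>i<N. (inv w ^^ i) v)" for v
    have avg_fixed: "w (avg v) = avg v" for v
    proof -
      have lin: "linear (inv w)" using weyl_linear[OF weyl_inv[OF w]] .
      have "inv w (\<Sum>i<N. (inv w ^^ i) v) = (\<Sum>i<N. (inv w ^^ Suc i) v)"
        by (simp add: linear_sum[OF lin])
      also have "\<dots> = (\<Sum>i<N. (inv w ^^ i) v)"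
        using sum.lessThan_Suc_shift[of "\<lambda>i. (inv w ^^ i) v" N] N(2)
        by simp
      finally have "inv w (avg v) = avg v" by (simp add: avg_def linear_scale[OF lin])
      then show ?thesis using weyl_inv_simps(1)[OF w] by metis
    qed
    have average: "D (t w * (vec (avg v) * mon us)) = D (t w * (vec v * mon us))"
      if us: "length us < n" for v us
    proof -
      define f where "f v = D (t w * (vec v * mon us))" for v
      have f_add: "f (u + v) = f u + f v" for u v
        by (simp add: f_def vec_add distrib_left distrib_right D_add)
      have f_scale: "f (c *\<^sub>R v) = complex_of_real c * f v" for c v
        by (simp add: f_def vec_scale scaleH_mult_left scaleH_mult_right D_scale)
      have f_pow: "f ((inv w ^^ i) v) = f v" for i
        by (induction i) (simp_all add: f_def cycle[OF us, symmetric])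
      have "f 0 = 0" using f_scale[of 0 0] by simp
      then have "f (\<Sum>i\<in>A. (inv w ^^ i) v) = (\<Sum>i\<in>A. f ((inv w ^^ i) v))" for A
        by (induction A rule: infinite_finite_induct) (auto simp: f_add)
      then have "f (avg v) = f v" using N(1) by (simp add: avg_def f_scale f_pow)
      then show ?thesis by (simp add: f_def)
    qed
    have average_all: "length us + length us' = n \<Longrightarrow>
        D (t w * (mon (map avg us) * mon us')) = D (t w * (mon us * mon us'))" for us us'
    proof (induction us arbitrary: us')
      case (Cons u us)
      have "D (t w * (mon (map avg (u # us)) * mon us')) = D (t w * (mon (map avg us) * mon (avg u # us')))"
        by (simp add: mult.assoc mon_commute_vec_left)
      also have "\<dots> = D (t w * (mon us * mon (avg u # us')))"
        by (rule Cons.IH) (use Cons.prems in simp)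
      also have "\<dots> = D (t w * (vec (avg u) * mon (us @ us')))"
        by (simp add: mult.assoc mon_commute_vec_left)
      also have "\<dots> = D (t w * (vec u * mon (us @ us')))"
        by (rule average) (use Cons.prems in simp)
      also have "\<dots> = D (t w * (mon (u # us) * mon us'))" by (simp add: mult.assoc)
      finally show ?case .
    qed simp
    define ys where "ys = map avg vs"
    have 1: "D (t w * mon vs) = D (t w * mon ys)"
      using average_all[of vs "[]"] by (simp add: n_def ys_def)
    obtain u as where u: "u \<in> weyl" and as: "set as \<subseteq> \<Delta>" and conj: "u \<circ> w = word as \<circ> u"
      and elliptic: "\<And>x \<alpha>. word as x = x \<Longrightarrow> \<alpha> \<in> set as \<Longrightarrow> pair x (coroot \<alpha>) = 0"
      using conjugate_elliptic_in_parabolic[OF w] by blast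
    have w': "word as \<in> weyl" using as simple_subset by (intro word_weyl) blast
    obtain r where r: "r \<in> below_degree n" "mon ys * t (inv u) = t (inv u) * mon (map u ys) + r"
      using mon_t[OF weyl_inv[OF u], of ys] weyl_inv_simps(5)[OF u] by (auto simp: ys_def n_def)
    have tt: "t u * t w = t (word as) * t u"
      using t_mult[OF u w] t_mult[OF w' u] conj by simp
    have uu: "t (inv u) * t u = 1" "t u * t (inv u) = 1"
      using t_mult[OF weyl_inv[OF u] u] t_mult[OF u weyl_inv[OF u]] weyl_inv_simps[OF u] t_id by simp_all
    have "D (t w * mon ys) = D ((t w * mon ys * t (inv u)) * t u)"
      by (simp add: mult.assoc uu)
    also have "\<dots> = D (t u * t w * (mon ys * t (inv u)))"
      by (subst D_comm) (simp add: mult.assoc)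
    also have "\<dots> = D (t (word as) * (t u * t (inv u)) * mon (map u ys)) + D (t u * (t w * r))"
      unfolding r(2) by (simp add: tt distrib_left D_add mult.assoc[symmetric])
    also have "D (t u * (t w * r)) = 0"
      by (intro low t_below_degree u w r)
    also have "t (word as) * (t u * t (inv u)) * mon (map u ys) = t (word as) * mon (map u ys)"
      by (simp add: uu)
    also have "D (t (word as) * mon (map u ys)) = 0"
    proof (rule D_parabolic[OF as], intro ballI)
      fix y \<alpha> assume y: "y \<in> set (map u ys)" and \<alpha>: "\<alpha> \<in> set as"
      obtain v where "y = u (avg v)" using y by (auto simp: ys_def)
      then have "word as y = y" using fun_cong[OF conj, of "avg v"] avg_fixed by simp
      then show "pair y (coroot \<alpha>) = 0" using elliptic \<alpha> by blast
    qed
    finally show ?case using 1 by simp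
  qed
  have "h \<in> H.span {t w * mon vs |w vs. w \<in> weyl}" using span_t_mon by simp
  then show ?thesis by (rule D_span) (use main in auto)
qed

lemma vec_commute_parabolic:
  assumes "set as \<subseteq> \<Delta>" "\<forall>\<alpha>\<in>set as. pair v (coroot \<alpha>) = 0"
  shows "vec v * t (word as) = t (word as) * vec v"
  using assms
proof (induction as)
  case Nil
  then show ?case using t_id by (simp add: id_def)
next
  case (Cons \<alpha> as)
  have \<alpha>: "\<alpha> \<in> \<Delta>" using Cons.prems by simp
  have w: "s \<alpha> \<in> weyl" "word as \<in> weyl"
    using weyl_refl[OF simple_root[OF \<alpha>] weyl_id] Cons.prems(1) simple_subset
    by (auto intro: word_weyl)
  have "vec v * t (word (\<alpha> # as)) = (vec v * t (s \<alpha>)) * t (word as)"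
    by (simp add: t_mult[OF w] mult.assoc)
  also have "vec v * t (s \<alpha>) = t (s \<alpha>) * vec v"
    using vec_t_simple[OF \<alpha>, of v] Cons.prems(2) by (simp add: refl_def)
  also have "t (s \<alpha>) * vec v * t (word as) = t (s \<alpha>) * (t (word as) * vec v)"
    using Cons by (simp add: mult.assoc)
  also have "\<dots> = t (word (\<alpha> # as)) * vec v"
    by (simp add: t_mult[OF w] mult.assoc)
  finally show ?case .
qed

lemma bullet_simps:
  assumes "is_bullet bul"
  shows bullet_add: "bul (g + h) = bul g + bul h"
    and bullet_scale: "bul (scaleH c h) = scaleH (cnj c) (bul h)"
    and bullet_mult: "bul (g * h) = bul h * bul g"
    and bullet_t: "w \<in> weyl \<Longrightarrow> bul (t w) = t (inv w)"
    and bullet_cpair: "bul (\<iota> (cpair pair \<omega>)) = \<iota> (cpair pair (cconj \<omega>))"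
  using assms unfolding is_bullet_def by blast+

lemma bullet_mon:
  assumes "is_bullet bul"
  shows "bul (mon vs) = mon vs"
proof -
  have "bul 1 = 1" using bullet_t[OF assms weyl_id] t_id by simp
  moreover have "bul (vec v) = vec v" for v
    using bullet_cpair[OF assms, of "(v, 0)"] by (simp add: vec_def cconj_def)
  ultimately show ?thesis
    by (induction vs) (simp_all add: bullet_mult[OF assms] mon_commute_vec)
qed

text \<open>The square of the involution is linear and multiplicative and fixes the generators.\<close>

lemma bullet_bullet:
  assumes "is_bullet bul"
  shows "bul (bul h) = h"
proof -
  have "h \<in> H.span {t w * mon vs |w vs. w \<in> weyl}" using span_t_mon by simp
  then show ?thesis
  proof (induction rule: H.span_induct_alt)
    case base
    show ?case using bullet_scale[OF assms, of 0 0] by simp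
  next
    case (step c x y)
    then show ?case
      by (auto simp: bullet_add[OF assms] bullet_scale[OF assms] bullet_mult[OF assms]
          bullet_t[OF assms] bullet_mon[OF assms] weyl_inv weyl_inv_simps)
  qed
qed

end

section \<open>Modules with real central character\<close>

context graded_hecke_algebra
begin

lemma \<iota>_scale: "\<iota> (\<lambda>l. c * a l) = scaleH c (\<iota> a)" if "a \<in> sym_alg"
  using \<iota>_mult[OF sym_const that] by (simp add: \<iota>_const scaleH_mult_left)

lemma sym_uminus: "a \<in> sym_alg \<Longrightarrow> (\<lambda>l. - a l) \<in> sym_alg"
  using sym_mult[OF sym_const[of "-1"], of a] by simp

lemma sym_power: "a \<in> sym_alg \<Longrightarrow> (\<lambda>l. a l ^ n) \<in> sym_alg"
  by (induction n) (auto intro: sym_const sym_mult)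

lemma sym_sum: "(\<And>i. i \<in> A \<Longrightarrow> f i \<in> sym_alg) \<Longrightarrow> (\<lambda>l. \<Sum>i\<in>A. f i l) \<in> sym_alg"
  by (induction A rule: infinite_finite_induct) (auto intro: sym_const sym_add)

lemma \<iota>_power: "a \<in> sym_alg \<Longrightarrow> \<iota> (\<lambda>l. a l ^ n) = \<iota> a ^ n"
  by (induction n) (simp_all add: \<iota>_const \<iota>_mult sym_power)

lemma \<iota>_sum: "(\<And>i. i \<in> A \<Longrightarrow> f i \<in> sym_alg) \<Longrightarrow> \<iota> (\<lambda>l. \<Sum>i\<in>A. f i l) = (\<Sum>i\<in>A. \<iota> (f i))"
  by (induction A rule: infinite_finite_induct) (simp_all add: \<iota>_const \<iota>_add sym_sum)

definition linear_factors :: "'h \<Rightarrow> complex list \<Rightarrow> 'h" where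
  "linear_factors g cs = prod_list (map (\<lambda>c. g - scaleH c 1) cs)"

lemma linear_factors_simps [simp]:
  "linear_factors g [] = 1"
  "linear_factors g (c # cs) = (g - scaleH c 1) * linear_factors g cs"
  by (simp_all add: linear_factors_def)

lemma linear_factors_commute:
  assumes "h * g = g * h"
  shows "h * linear_factors g cs = linear_factors g cs * h"
proof (induction cs)
  case (Cons c cs)
  have "h * (g - scaleH c 1) = (g - scaleH c 1) * h"
    by (simp add: assms left_diff_distrib right_diff_distrib scaleH_mult_left scaleH_mult_right)
  then have "h * linear_factors g (c # cs) = (g - scaleH c 1) * (h * linear_factors g cs)"
    by (simp add: mult.assoc[symmetric])
  then show ?case by (simp add: Cons mult.assoc)
qed simp

lemma linear_factors_snoc:
  "linear_factors g (cs @ [c]) = linear_factors g cs * (g - scaleH c 1)"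
  by (induction cs) (simp_all add: mult.assoc)

lemma \<iota>_linear_factors:
  "\<iota> (\<lambda>l. prod_list (map (\<lambda>c. cpair pair (v, 0) l - c) cs)) = linear_factors (vec v) cs
   \<and> (\<lambda>l. prod_list (map (\<lambda>c. cpair pair (v, 0) l - c) cs)) \<in> sym_alg"
proof (induction cs)
  case Nil
  then show ?case using \<iota>_const[of 1] sym_const[of 1] by simp
next
  case (Cons c cs)
  have f: "(\<lambda>l. cpair pair (v, 0) l - c) \<in> sym_alg"
    using sym_add[OF sym_vec[of "(v, 0)"] sym_const[of "- c"]] by simp
  have "\<iota> (\<lambda>l. cpair pair (v, 0) l - c) = vec v - scaleH c 1"
    using \<iota>_add[OF sym_vec[of "(v, 0)"] sym_const[of "- c"]] by (simp add: vec_def \<iota>_const)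
  then show ?case
    using \<iota>_mult[OF f Cons[THEN conjunct2]] sym_mult[OF f Cons[THEN conjunct2]] Cons by simp
qed

text \<open>The polynomial \<open>\<Prod>\<^sub>w (T - w v)\<close> over the ring of polynomial functions.\<close>

definition orbit_poly :: "'v \<Rightarrow> 'd cplxn \<Rightarrow> complex poly" where
  "orbit_poly v l = (\<Prod>w\<in>weyl. [:- cpair pair (w v, 0) l, 1:])"

lemma coeff_orbit_poly:
  shows coeff_orbit_poly_inv: "(\<lambda>l. coeff (orbit_poly v l) i) \<in> sym_inv"
    and degree_orbit_poly: "degree (orbit_poly v l) \<le> card weyl"
proof -
  have "(\<lambda>l. coeff (\<Prod>w\<in>A. [:- cpair pair (w v, 0) l, 1:]) i) \<in> sym_alg" if "finite A" for A
    using that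
  proof (induction A arbitrary: i rule: finite_induct)
    case empty
    then show ?case using sym_const[of "coeff 1 i"] by simp
  next
    case (insert w A)
    define q where "q l = (\<Prod>w\<in>A. [:- cpair pair (w v, 0) l, 1:])" for l
    have shift: "(\<lambda>l. coeff (pCons 0 (q l)) i) \<in> sym_alg"
      using insert.IH sym_const[of 0] by (cases i) (simp_all add: q_def)
    have "(\<lambda>l. - cpair pair (w v, 0) l * coeff (q l) i + coeff (pCons 0 (q l)) i) \<in> sym_alg"
      using insert.IH[of i] unfolding q_def[symmetric]
      by (intro sym_add sym_mult sym_uminus sym_vec shift) 
    then show ?case using insert.hyps by (simp add: q_def)
  qed
  then have mem: "(\<lambda>l. coeff (orbit_poly v l) i) \<in> sym_alg"
    unfolding orbit_poly_def using finite_weyl by blast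
  have "sym_act u (\<lambda>l. coeff (orbit_poly v l) i) = (\<lambda>l. coeff (orbit_poly v l) i)"
    if u: "u \<in> weyl" for u
  proof -
    have "orbit_poly v (cdual_act (inv u) l) = orbit_poly v l" for l
    proof -
      have "orbit_poly v (cdual_act (inv u) l) = (\<Prod>w\<in>weyl. [:- cpair pair ((u \<circ> w) v, 0) l, 1:])"
        unfolding orbit_poly_def cpair_dual_act[OF u] using linear_0[OF weyl_linear[OF u]] by simp
      also have "\<dots> = orbit_poly v l"
        unfolding orbit_poly_def
        by (rule prod.reindex_bij_witness[of _ "\<lambda>w. inv u \<circ> w" "\<lambda>w. u \<circ> w"])
          (auto simp: weyl_comp u weyl_inv weyl_inv_simps[OF u] comp_assoc[symmetric])
      finally show ?thesis .
    qed
    then show ?thesis by (simp add: sym_act_def)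
  qed
  with mem show "(\<lambda>l. coeff (orbit_poly v l) i) \<in> sym_inv" by (simp add: sym_inv_def)
  show "degree (orbit_poly v l) \<le> card weyl"
    using degree_prod_sum_le[OF finite_weyl, of "\<lambda>w. [:- cpair pair (w v, 0) l, 1:]"]
    by (simp add: orbit_poly_def)
qed

end

context graded_hecke_module
begin

sublocale complex_algebra_module scaleX scaleH \<pi>
proof -
  interpret vector_space scaleX by (rule X_vector_space)
  show "complex_algebra_module scaleX scaleH \<pi>"
    by unfold_locales (simp_all add: \<pi>_add \<pi>_scale \<pi>_one \<pi>_mult
        module_hom.add[OF Vector_Spaces.linear.axioms(3)[OF \<pi>_linear]]
        module_hom.scale[OF Vector_Spaces.linear.axioms(3)[OF \<pi>_linear]])
qed

lemma act_H_span:
  assumes "\<And>g. g \<in> A \<Longrightarrow> \<pi> g x \<in> U" "subspace U" "h \<in> H.span A"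
  shows "\<pi> h x \<in> U"
  using assms(3)
  by (induction rule: H.span_induct_alt)
    (use assms(1,2) in \<open>auto simp: act_0 act_add act_scale intro: subspace_0 subspace_add subspace_scale\<close>)

lemma act_span:
  assumes "\<And>y. y \<in> F \<Longrightarrow> \<pi> h y \<in> U" "subspace U" "x \<in> span F"
  shows "\<pi> h x \<in> U"
  using assms(3)
  by (induction rule: span_induct_alt)
    (use assms(1,2) in \<open>auto simp: act_vec_0 act_vec_add act_vec_scale intro: subspace_0 subspace_add subspace_scale\<close>)

text \<open>By Cayley-Hamilton for the polynomial \<open>\<Prod>\<^sub>w (T - w v)\<close>: its coefficients are invariant, so on the
  module they act by their values at the central character \<open>\<lambda>\<close>.\<close>

lemma vec_annihilated:
  assumes "has_real_central_character"
  shows "\<exists>cs. set cs \<subseteq> \<real> \<and> (\<forall>x. \<pi> (linear_factors (vec v) cs) x = 0)"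
proof -
  obtain l0 where orbit: "weyl_orbit l0 \<subseteq> {l. snd l = 0}"
    and central: "\<And>z x. z \<in> sym_inv \<Longrightarrow> \<pi> (\<iota> z) x = scaleX (z l0) x"
    using assms unfolding has_real_central_character_def has_central_character_def by blast
  have "cdual_act id l0 \<in> weyl_orbit l0" by (auto simp: weyl_orbit_def intro: weyl_id)
  then have "snd (cdual_act id l0) = 0" using orbit by blast
  then have "pair u (dual_act id (snd l0)) = 0" for u
    using linear_0[OF linear_right] by (simp add: cdual_act_def)
  then have real: "cpair pair (u, 0) l0 \<in> \<real>" for u
    using pair_dual_act[OF weyl_id, of u "snd l0"] by (simp add: cpair_real complex_is_Real_iff)
  obtain ws where ws: "set ws = weyl" "distinct ws"
    using finite_distinct_list[OF finite_weyl] by blast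
  define cs where "cs = map (\<lambda>w. cpair pair (w v, 0) l0) ws"
  define z where "z = cpair pair (v, 0)"
  define e where "e i l = coeff (orbit_poly v l) i" for i l
  have e: "e i \<in> sym_inv" "e i \<in> sym_alg" for i
    using coeff_orbit_poly_inv[of v i] unfolding e_def sym_inv_def by auto
  have z: "z \<in> sym_alg" by (simp add: z_def sym_vec)
  have poly_eq: "poly (orbit_poly v l) c = (\<Sum>i\<le>card weyl. e i l * c ^ i)" for l c
    unfolding poly_altdef e_def
    by (rule sum.mono_neutral_left) (auto simp: degree_orbit_poly coeff_eq_0 intro: order_trans[OF _ degree_orbit_poly])
  have act_eq: "\<pi> (\<iota> (\<lambda>l. \<Sum>i\<le>card weyl. e i l0 * z l ^ i)) x = \<pi> (\<iota> (\<lambda>l. \<Sum>i\<le>card weyl. e i l * z l ^ i)) x" for x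
  proof -
    have "\<iota> (\<lambda>l. \<Sum>i\<le>card weyl. e i l0 * z l ^ i) = (\<Sum>i\<le>card weyl. scaleH (e i l0) (\<iota> z ^ i))"
      by (subst \<iota>_sum) (auto simp: \<iota>_scale sym_power \<iota>_power z intro: sym_mult sym_const)
    moreover have "\<iota> (\<lambda>l. \<Sum>i\<le>card weyl. e i l * z l ^ i) = (\<Sum>i\<le>card weyl. \<iota> (e i) * \<iota> z ^ i)"
      by (subst \<iota>_sum) (auto simp: \<iota>_mult sym_power \<iota>_power z e intro: sym_mult)
    ultimately show ?thesis
      by (simp add: act_sum act_scale act_mult central[OF e(1)])
  qed
  have root: "(\<lambda>l. \<Sum>i\<le>card weyl. e i l * z l ^ i) = (\<lambda>l. 0)"
  proof
    fix l
    have "poly (orbit_poly v l) (z l) = 0"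
      unfolding orbit_poly_def poly_prod
      by (rule prod_zero[OF finite_weyl]) (auto simp: z_def intro: bexI[of _ id] weyl_id)
    then show "(\<Sum>i\<le>card weyl. e i l * z l ^ i) = 0" by (simp add: poly_eq)
  qed
  have factored: "(\<lambda>l. \<Sum>i\<le>card weyl. e i l0 * z l ^ i) = (\<lambda>l. prod_list (map (\<lambda>c. z l - c) cs))"
  proof
    fix l
    have "(\<Sum>i\<le>card weyl. e i l0 * z l ^ i) = (\<Prod>w\<in>weyl. z l - cpair pair (w v, 0) l0)"
      unfolding poly_eq[symmetric] by (simp add: orbit_poly_def poly_prod)
    also have "\<dots> = prod_list (map (\<lambda>c. z l - c) cs)"
      using prod.distinct_set_conv_list[OF ws(2), of "\<lambda>w. z l - cpair pair (w v, 0) l0"]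
      by (simp add: ws(1) cs_def comp_def)
    finally show "(\<Sum>i\<le>card weyl. e i l0 * z l ^ i) = prod_list (map (\<lambda>c. z l - c) cs)" .
  qed
  have "\<pi> (linear_factors (vec v) cs) x = 0" for x
  proof -
    have "linear_factors (vec v) cs = \<iota> (\<lambda>l. \<Sum>i\<le>card weyl. e i l0 * z l ^ i)"
      using \<iota>_linear_factors[of v cs] unfolding factored by (simp add: z_def)
    then have "\<pi> (linear_factors (vec v) cs) x = \<pi> (\<iota> (\<lambda>l. 0)) x"
      by (simp only: act_eq root)
    then show ?thesis by (simp add: \<iota>_const act_0)
  qed
  moreover have "set cs \<subseteq> \<real>" using real by (auto simp: cs_def)
  ultimately show ?thesis by blast
qed

text \<open>One adds to \<open>F\<close> its images under the partial products of \<open>(g - c\<^sub>1) \<dots> (g - c\<^sub>n) = 0\<close>: applying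
  \<open>g\<close> to one of them gives a combination of it and the next. Elements commuting with \<open>g\<close> commute
  with the partial products, so invariance under them is not lost.\<close>

lemma finite_closure_under_annihilated:
  assumes F: "finite F" and ann: "\<And>x. \<pi> (linear_factors g cs) x = 0"
  shows "\<exists>F'. finite F' \<and> F \<subseteq> F' \<and> (\<forall>y\<in>F'. \<pi> g y \<in> span F') \<and>
    (\<forall>h. h * g = g * h \<longrightarrow> (\<forall>y\<in>F. \<pi> h y \<in> span F) \<longrightarrow> (\<forall>y\<in>F'. \<pi> h y \<in> span F'))"
proof -
  define P where "P i = linear_factors g (take i cs)" for i
  define F' where "F' = (\<lambda>(i, y). \<pi> (P i) y) ` ({..length cs} \<times> F)"
  have F'_mem: "\<pi> (P i) y \<in> F'" if "i \<le> length cs" "y \<in> F" for i y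
    unfolding F'_def using that by (intro image_eqI[of _ _ "(i, y)"]) auto
  have fin: "finite F'" using F by (simp add: F'_def)
  have sub: "F \<subseteq> F'"
    using F'_mem[of 0] by (auto simp: P_def act_one)
  have closed: "\<pi> g y' \<in> span F'" if "y' \<in> F'" for y'
  proof -
    obtain i y where y: "i \<le> length cs" "y \<in> F" "y' = \<pi> (P i) y"
      using \<open>y' \<in> F'\<close> unfolding F'_def by auto
    have comm: "g * P i = P i * g" unfolding P_def by (rule linear_factors_commute) simp
    show ?thesis
    proof (cases "i < length cs")
      case True
      have "P (Suc i) = P i * (g - scaleH (cs ! i) 1)"
        using True by (simp add: P_def take_Suc_conv_app_nth linear_factors_snoc)
      then have "g * P i = P (Suc i) + scaleH (cs ! i) (P i)"
        by (simp add: comm right_diff_distrib scaleH_mult_right)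
      then have "\<pi> g y' = \<pi> (P (Suc i)) y + scaleX (cs ! i) (\<pi> (P i) y)"
        by (simp add: y(3) act_mult[symmetric] act_add act_scale)
      moreover have "\<pi> (P (Suc i)) y \<in> span F'" "\<pi> (P i) y \<in> span F'"
        using True y F'_mem by (auto intro: span_base)
      ultimately show ?thesis by (simp add: span_add span_scale)
    next
      case False
      then have "y' = 0" using y ann by (simp add: P_def)
      then show ?thesis by (simp add: act_vec_0 span_zero)
    qed
  qed
  have other: "\<pi> h y' \<in> span F'"
    if h: "h * g = g * h" "\<forall>y\<in>F. \<pi> h y \<in> span F" and "y' \<in> F'" for h y'
  proof -
    obtain i y where y: "i \<le> length cs" "y \<in> F" "y' = \<pi> (P i) y"
      using \<open>y' \<in> F'\<close> unfolding F'_def by auto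
    have "\<pi> h y' = \<pi> (P i) (\<pi> h y)"
      using linear_factors_commute[OF h(1), of "take i cs"]
      by (simp add: y(3) P_def act_mult[symmetric])
    also have "\<dots> \<in> span F'"
    proof (rule act_span)
      show "\<pi> h y \<in> span F" using h(2) y(2) by blast
      show "\<pi> (P i) y \<in> span F'" if "y \<in> F" for y
        using F'_mem[OF y(1) that] by (rule span_base)
    qed (rule subspace_span)
    finally show ?thesis .
  qed
  show ?thesis
    using fin sub closed other by (intro exI[of _ F'] conjI ballI allI impI) simp_all
qed

lemma finite_vec_invariant:
  assumes "has_real_central_character"
  shows "\<exists>F. finite F \<and> x \<in> F \<and> (\<forall>v. \<forall>y\<in>F. \<pi> (vec v) y \<in> span F)"
proof -
  have step: "\<exists>F. finite F \<and> x \<in> F \<and> (\<forall>b\<in>B. \<forall>y\<in>F. \<pi> (vec b) y \<in> span F)" if "finite B" for B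
    using that
  proof (induction B rule: finite_induct)
    case empty
    show ?case by (intro exI[of _ "{x}"]) auto
  next
    case (insert b B)
    from insert.IH obtain F where
      F: "finite F" "x \<in> F" "\<forall>b\<in>B. \<forall>y\<in>F. \<pi> (vec b) y \<in> span F" by (elim exE conjE)
    obtain cs where "\<forall>x. \<pi> (linear_factors (vec b) cs) x = 0"
      using vec_annihilated[OF assms, of b] by (elim exE conjE)
    from finite_closure_under_annihilated[OF F(1) spec[OF this]] obtain F' where
      F': "finite F'" "F \<subseteq> F'" "\<forall>y\<in>F'. \<pi> (vec b) y \<in> span F'"
      "\<forall>h. h * vec b = vec b * h \<longrightarrow> (\<forall>y\<in>F. \<pi> h y \<in> span F) \<longrightarrow> (\<forall>y\<in>F'. \<pi> h y \<in> span F')"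
      by (elim exE conjE)
    have "\<pi> (vec c) y \<in> span F'" if "c \<in> insert b B" "y \<in> F'" for c y
    proof (cases "c = b")
      case True
      then show ?thesis using F'(3) that(2) by simp
    next
      case False
      then have "\<forall>y\<in>F. \<pi> (vec c) y \<in> span F" using F(3) that(1) by simp
      from F'(4)[rule_format, OF vec_commute this[rule_format]] show ?thesis using that(2) by simp
    qed
    moreover have "x \<in> F'" using F(2) F'(2) by blast
    ultimately show ?case using F'(1) by (intro exI[of _ F']) simp
  qed
  obtain B :: "'v set" where B: "finite B" "Real_Vector_Spaces.span B = UNIV"
    using finite_dim_V by blast
  from step[OF B(1)] obtain F where
    F: "finite F" "x \<in> F" "\<forall>b\<in>B. \<forall>y\<in>F. \<pi> (vec b) y \<in> span F" by (elim exE conjE)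
  have "\<pi> (vec v) y \<in> span F" if y: "y \<in> F" for v y
  proof -
    have "v \<in> Real_Vector_Spaces.span B" using B by simp
    then show ?thesis
    proof (induction rule: real_vector.span_induct_alt)
      case base
      have "vec 0 = 0" using vec_scale[of 0 0] by simp
      then show ?case by (simp add: span_zero act_0)
    next
      case (step c u v)
      have "\<pi> (vec c') y \<in> span F" if "c' \<in> B" for c' using F(3) y that by blast
      then show ?case
        using step by (auto simp: vec_add vec_scale act_add act_scale intro!: span_add span_scale)
    qed
  qed
  then show ?thesis by (intro exI[of _ F] conjI allI ballI F(1,2)) assumption
qed

text \<open>A nonzero vector lies in a finite dimensional subspace invariant under all \<open>vec v\<close>; its finitely
  many translates by the \<open>t\<^sub>w\<close> span a submodule, by the commutation rule \<open>vec_t\<close>.\<close>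

lemma irreducible_finite_dim:
  assumes irr: "irreducible" and rcc: "has_real_central_character"
  shows "\<exists>F. finite F \<and> span F = UNIV"
proof -
  obtain x :: 'x where x: "x \<noteq> 0" using irr unfolding irreducible_def by blast
  obtain F where F: "finite F" "x \<in> F" "\<And>v y. y \<in> F \<Longrightarrow> \<pi> (vec v) y \<in> span F"
    using finite_vec_invariant[OF rcc, of x] by blast
  define F2 where "F2 = (\<lambda>(w, y). \<pi> (t w) y) ` (weyl \<times> F)"
  have mem: "\<pi> (t w) y \<in> span F2" if "w \<in> weyl" "y \<in> span F" for w y
  proof (rule act_span[OF _ _ that(2)])
    fix y assume "y \<in> F"
    then show "\<pi> (t w) y \<in> span F2"
      unfolding F2_def using that(1) by (intro span_base image_eqI[of _ _ "(w, y)"]) auto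
  qed simp
  have t_closed: "\<pi> (t u) y \<in> span F2" if u: "u \<in> weyl" and y: "y \<in> span F2" for u y
  proof (rule act_span[OF _ _ y])
    fix y assume "y \<in> F2"
    then obtain w z where z: "w \<in> weyl" "z \<in> F" "y = \<pi> (t w) z" by (auto simp: F2_def)
    then have "\<pi> (t u) y = \<pi> (t (u \<circ> w)) z" by (simp add: t_mult[OF u] act_mult)
    then show "\<pi> (t u) y \<in> span F2" using mem[OF weyl_comp[OF u z(1)] span_base[OF z(2)]] by simp
  qed simp
  have vec_closed: "\<pi> (vec v) y \<in> span F2" if y: "y \<in> span F2" for v y
  proof (rule act_span[OF _ _ y])
    fix y assume "y \<in> F2"
    then obtain w z where z: "w \<in> weyl" "z \<in> F" "y = \<pi> (t w) z" by (auto simp: F2_def)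
    obtain q where q: "q \<in> H.span (t ` weyl)" "vec v * t w = t w * vec (inv w v) + q"
      using vec_t[OF z(1)] by blast
    have "\<pi> (vec v) y = \<pi> (vec v * t w) z" by (simp add: z(3) act_mult)
    also have "\<dots> = \<pi> (t w) (\<pi> (vec (inv w v)) z) + \<pi> q z"
      by (simp add: q(2) act_add act_mult)
    also have "\<dots> \<in> span F2"
    proof (rule span_add)
      show "\<pi> (t w) (\<pi> (vec (inv w v)) z) \<in> span F2" by (intro mem z F(3))
      show "\<pi> q z \<in> span F2"
        by (rule act_H_span[OF _ _ q(1)]) (use z(2) in \<open>auto intro: mem span_base\<close>)
    qed
    finally show "\<pi> (vec v) y \<in> span F2" .
  qed simp
  have mon_closed: "y \<in> span F2 \<Longrightarrow> \<pi> (mon vs) y \<in> span F2" for vs y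
    by (induction vs) (auto simp: act_one act_mult vec_closed)
  have "\<pi> h y \<in> span F2" if y: "y \<in> span F2" for h y
  proof (rule act_H_span[where A = "{t w * mon vs |w vs. w \<in> weyl}"])
    show "h \<in> H.span {t w * mon vs |w vs. w \<in> weyl}" using span_t_mon by simp
  qed (use y in \<open>auto simp: act_mult t_closed mon_closed\<close>)
  moreover have "x \<in> span F2"
    using mem[OF weyl_id span_base[OF F(2)]] by (simp add: t_id act_one)
  ultimately have "span F2 = UNIV"
    using irreducible_submodule[OF irr subspace_span, of F2 x] x by blast
  moreover have "finite F2" using F(1) finite_weyl by (simp add: F2_def)
  ultimately show ?thesis by blast
qed

text \<open>In a basis in which the commuting operators are all triangular, the diagonal entries of
  \<open>t\<^sub>w\<close> and of \<open>t\<^sub>w\<close> inverse are mutually inverse roots of unity, hence conjugate, and those of the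
  monomial are real.\<close>

lemma trace_commuting:
  assumes fin: "finite B0" "independent B0" "span B0 = UNIV" and rcc: "has_real_central_character"
    and w: "w \<in> weyl" and comm: "\<And>v. v \<in> set vs \<Longrightarrow> vec v * t w = t w * vec v"
  shows "trace_wrt B0 (\<pi> (mon vs * t (inv w))) = cnj (trace_wrt B0 (\<pi> (t w * mon vs)))"
proof -
  have tt: "t w * t (inv w) = 1" "t (inv w) * t w = 1"
    using t_mult[OF w weyl_inv[OF w]] t_mult[OF weyl_inv[OF w] w] weyl_inv_simps[OF w] t_id by simp_all
  have comm': "vec v * t (inv w) = t (inv w) * vec v" if "v \<in> set vs" for v
  proof -
    have "vec v * t (inv w) = t (inv w) * (t w * vec v) * t (inv w)"
      by (simp add: mult.assoc[symmetric] tt)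
    also have "\<dots> = t (inv w) * vec v * (t w * t (inv w))"
      by (simp add: comm[OF that, symmetric] mult.assoc)
    finally show ?thesis by (simp add: tt)
  qed
  define S where "S = {t w, t (inv w)} \<union> vec ` set vs"
  have S_comm: "g * h = h * g" if "g \<in> S" "h \<in> S" for g h
    using that comm comm' vec_commute tt unfolding S_def by auto
  have "finite (\<pi> ` S)" by (simp add: S_def)
  then obtain B where B: "finite B" "independent B" "span B = UNIV"
    and tri: "\<And>b. b \<in> B \<Longrightarrow> \<exists>U \<chi>. subspace U \<and> (\<forall>f\<in>\<pi> ` S. f ` U \<subseteq> U) \<and>
        (\<forall>u\<in>U. representation B u b = 0) \<and> (\<forall>f\<in>\<pi> ` S. f b - scaleX (\<chi> f) b \<in> U)"
    using simultaneous_triangularization[OF fin(1,3), of "\<pi> ` S" thesis] S_comm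
    by (force simp: fun_eq_iff act_mult[symmetric] act_linear)
  have diag: "representation B (\<pi> (mon vs * t (inv w)) b) b
      = cnj (representation B (\<pi> (t w * mon vs) b) b)" if b: "b \<in> B" for b
  proof -
    from tri[OF b] obtain U \<chi> where U: "subspace U" "\<forall>g\<in>S. \<pi> g ` U \<subseteq> U"
      "\<forall>u\<in>U. representation B u b = 0" "\<forall>g\<in>S. \<pi> g b - scaleX (\<chi> (\<pi> g)) b \<in> U" by auto
    \<comment> \<open>\<open>ev g c\<close>: the diagonal entry of \<open>g\<close> at \<open>b\<close> is \<open>c\<close>.\<close>
    define ev where "ev g c \<longleftrightarrow> \<pi> g ` U \<subseteq> U \<and> \<pi> g b - scaleX c b \<in> U" for g c
    have ev_S: "ev g (\<chi> (\<pi> g))" if "g \<in> S" for g using U that by (simp add: ev_def)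
    have ev_1: "ev 1 1" using subspace_0[OF U(1)] by (auto simp: ev_def act_one)
    have ev_mult: "ev (g * h) (c * d)" if g: "ev g c" and h: "ev h d" for g h c d
    proof -
      have "\<pi> (g * h) b - scaleX (c * d) b = \<pi> g (\<pi> h b - scaleX d b) + scaleX d (\<pi> g b - scaleX c b)"
        by (simp add: act_mult act_vec_diff act_vec_scale scale_right_diff_distrib mult.commute)
      also have "\<dots> \<in> U"
        using g h by (intro subspace_add[OF U(1)] subspace_scale[OF U(1)]) (auto simp: ev_def)
      finally show ?thesis using g h by (auto simp: ev_def act_mult)
    qed
    have ev_diff: "ev (g - scaleH d 1) (c - d)" if g: "ev g c" for g c d
    proof -
      have "\<pi> (g - scaleH d 1) b - scaleX (c - d) b = \<pi> g b - scaleX c b"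
        by (simp add: act_diff act_scale act_one scale_left_diff_distrib)
      moreover have "\<pi> (g - scaleH d 1) u \<in> U" if "u \<in> U" for u
        using g that U(1) by (auto simp: ev_def act_diff act_scale act_one intro!: subspace_diff subspace_scale)
      ultimately show ?thesis using g by (auto simp: ev_def)
    qed
    have ev_rep: "representation B (\<pi> g b) b = c" if "ev g c" for g c
    proof -
      have "representation B (\<pi> g b) b = representation B ((\<pi> g b - scaleX c b) + scaleX c b) b" by simp
      also have "\<dots> = 0 + c * representation B b b"
        using that U(3) B by (subst representation_add) (auto simp: ev_def representation_scale)
      finally show ?thesis using b B by (simp add: representation_basis)
    qed
    define \<zeta> where "\<zeta> = \<chi> (\<pi> (t w))"
    define \<zeta>' where "\<zeta>' = \<chi> (\<pi> (t (inv w)))"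
    have \<zeta>: "ev (t w) \<zeta>" "ev (t (inv w)) \<zeta>'"
      using ev_S by (simp_all add: \<zeta>_def \<zeta>'_def S_def)
    have one: "\<zeta> * \<zeta>' = 1"
      using ev_rep[OF ev_mult[OF \<zeta>]] ev_rep[OF ev_1] tt by simp
    obtain N where N: "N > 0" "w ^^ N = id" using weyl_finite_order[OF w] by blast
    have "ev (t (w ^^ n)) (\<zeta> ^ n)" for n
    proof (induction n)
      case 0
      show ?case using ev_1 t_id by (simp add: id_def)
    next
      case (Suc n)
      have "t (w ^^ Suc n) = t w * t (w ^^ n)"
        by (simp only: funpow.simps t_mult[OF w weyl_funpow[OF w]])
      then show ?case using ev_mult[OF \<zeta>(1) Suc] by (simp only: power_Suc)
    qed
    from ev_rep[OF this[of N]] have "\<zeta> ^ N = 1" using ev_rep[OF ev_1] N(2) t_id by simp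
    then have "norm \<zeta> = 1" using N(1) power_eq_1_iff by blast
    then have "\<zeta> * cnj \<zeta> = 1" using complex_norm_square[of \<zeta>] by simp
    then have conj: "\<zeta>' = cnj \<zeta>" using one by (metis mult.left_commute mult.right_neutral)
    have real: "\<chi> (\<pi> (vec v)) \<in> \<real>" if v: "v \<in> set vs" for v
    proof -
      obtain cs where cs: "set cs \<subseteq> \<real>" "\<And>x. \<pi> (linear_factors (vec v) cs) x = 0"
        using vec_annihilated[OF rcc] by blast
      have ev_v: "ev (vec v) (\<chi> (\<pi> (vec v)))" using ev_S v by (simp add: S_def)
      have "ev (linear_factors (vec v) ds) (prod_list (map (\<lambda>d. \<chi> (\<pi> (vec v)) - d) ds))" for ds
        by (induction ds) (auto intro: ev_1 ev_mult ev_diff ev_v)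
      from ev_rep[OF this[of cs]] have "prod_list (map (\<lambda>d. \<chi> (\<pi> (vec v)) - d) cs) = 0"
        by (simp add: cs(2) representation_zero)
      then have "\<chi> (\<pi> (vec v)) \<in> set cs" by (auto simp: prod_list_zero_iff)
      then show ?thesis using cs(1) by blast
    qed
    have "set us \<subseteq> set vs \<Longrightarrow> \<exists>r\<in>\<real>. ev (mon us) r" for us
    proof (induction us)
      case Nil
      then show ?case using ev_1 by auto
    next
      case (Cons u us)
      then obtain r where "r \<in> \<real>" "ev (mon us) r" by auto
      moreover have "ev (vec u) (\<chi> (\<pi> (vec u)))" using ev_S Cons.prems by (simp add: S_def)
      moreover have "\<chi> (\<pi> (vec u)) \<in> \<real>" using real Cons.prems by simp
      ultimately show ?case using ev_mult by (intro bexI[of _ "\<chi> (\<pi> (vec u)) * r"]) auto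
    qed
    then obtain r where r: "r \<in> \<real>" "ev (mon vs) r" by blast
    then show ?thesis
      using ev_rep[OF ev_mult[OF \<zeta>(1) r(2)]] ev_rep[OF ev_mult[OF r(2) \<zeta>(2)]]
      by (simp add: conj Reals_cnj_iff mult.commute)
  qed
  have "trace_wrt B (\<pi> (mon vs * t (inv w))) = cnj (trace_wrt B (\<pi> (t w * mon vs)))"
    unfolding trace_wrt_def using diag by simp
  then show ?thesis
    using trace_wrt_independent[OF B(2,3,1) fin(2,3,1) act_linear] by simp
qed

theorem trace_bullet:
  assumes fin: "finite B" "independent B" "span B = UNIV" and rcc: "has_real_central_character"
    and bul: "is_bullet bul"
  shows "trace_wrt B (\<pi> (bul h)) = cnj (trace_wrt B (\<pi> h))"
proof -
  define tr where "tr h = trace_wrt B (\<pi> h)" for h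
  have tr_add: "tr (g + h) = tr g + tr h" for g h
    using fin by (simp add: tr_def trace_wrt_def act_add representation_add sum.distrib)
  have tr_scale: "tr (scaleH c h) = c * tr h" for c h
    using fin by (simp add: tr_def trace_wrt_def act_scale representation_scale sum_distrib_left)
  have tr_comm: "tr (g * h) = tr (h * g)" for g h
    using trace_wrt_comp_commute[OF fin(2,3,1) fin(2,3,1) act_linear act_linear, of g h]
    by (simp add: tr_def trace_wrt_def act_mult)
  have "cnj (tr (bul h)) - tr h = 0"
  proof (rule trace_functional_zero[where D = "\<lambda>h. cnj (tr (bul h)) - tr h"])
    show "cnj (tr (bul (g + h))) - tr (g + h) = cnj (tr (bul g)) - tr g + (cnj (tr (bul h)) - tr h)" for g h
      by (simp add: bullet_add[OF bul] tr_add)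
    show "cnj (tr (bul (scaleH c h))) - tr (scaleH c h) = c * (cnj (tr (bul h)) - tr h)" for c h
      by (simp add: bullet_scale[OF bul] tr_scale right_diff_distrib)
    show "cnj (tr (bul (g * h))) - tr (g * h) = cnj (tr (bul (h * g))) - tr (h * g)" for g h
      by (simp add: bullet_mult[OF bul] tr_comm)
    show "cnj (tr (bul (t (word as) * mon vs))) - tr (t (word as) * mon vs) = 0"
      if as: "set as \<subseteq> \<Delta>" and orth: "\<forall>v\<in>set vs. \<forall>\<alpha>\<in>set as. pair v (coroot \<alpha>) = 0" for as vs
    proof -
      have w: "word as \<in> weyl" using as simple_subset by (intro word_weyl) blast
      have "bul (t (word as) * mon vs) = mon vs * t (inv (word as))"
        by (simp add: bullet_mult[OF bul] bullet_t[OF bul w] bullet_mon[OF bul])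
      then show ?thesis
        using trace_commuting[OF fin rcc w, of vs] vec_commute_parabolic[OF as] orth
        by (simp add: tr_def)
    qed
  qed
  then show ?thesis by (metis complex_cnj_cnj eq_iff_diff_eq_0 tr_def)
qed

end

theorem corollary5p1p3:
  fixes pair :: "'v::real_vector \<Rightarrow> 'd::real_vector \<Rightarrow> real"
    and R :: "'v set" and coroot :: "'v \<Rightarrow> 'd" and \<Delta> :: "'v set"
    and k :: "'v \<Rightarrow> real"
    and scaleH :: "complex \<Rightarrow> 'h::ring_1 \<Rightarrow> 'h"
    and t :: "('v \<Rightarrow> 'v) \<Rightarrow> 'h"
    and \<iota> :: "('d cplxn \<Rightarrow> complex) \<Rightarrow> 'h"
    and bul :: "'h \<Rightarrow> 'h"
    and scaleX :: "complex \<Rightarrow> 'x::ab_group_add \<Rightarrow> 'x"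
    and \<pi> :: "'h \<Rightarrow> 'x \<Rightarrow> 'x"
  assumes "graded_hecke_algebra pair R coroot \<Delta> k scaleH t \<iota>"
    and "graded_hecke_algebra.is_bullet pair R coroot scaleH t \<iota> bul"
    and "graded_hecke_module pair R coroot \<Delta> k scaleH t \<iota> scaleX \<pi>"
    and "graded_hecke_module.irreducible_module scaleX \<pi>"
    and "graded_hecke_module.tempered pair coroot \<Delta> \<iota> scaleX \<pi>"
    and "graded_hecke_module.has_real_central_character pair R coroot \<iota> scaleX \<pi>"
  shows "\<exists>form. hermitian_form scaleX form \<and> nondegenerate_form form \<and>
           graded_hecke_module.invariant_form \<pi> bul form"
proof -
  interpret graded_hecke_module pair R coroot \<Delta> k scaleH t \<iota> scaleX \<pi> by fact
  note bul = assms(2) and rcc = assms(6)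
  have irr: "irreducible"
    using assms(4) unfolding irreducible_module_def irreducible_def .
  obtain F where F: "finite F" "span F = UNIV"
    using irreducible_finite_dim[OF irr rcc] by blast
  obtain B where B: "independent B" "span B = UNIV"
    using basis_exists[of UNIV] by (metis top.extremum_uniqueI)
  have "finite B" using independent_span_bound[OF F(1) B(1)] F(2) by simp
  from invariant_hermitian_form_exists[OF this B irr bullet_mult[OF bul] bullet_bullet[OF bul]
      trace_bullet[OF this B rcc bul]]
  show ?thesis unfolding invariant_form_def .
qed

end
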